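(* Let $\mu\ge 0$ and let $n\ge 0$ be an integer. Let $a\in\mathbb R$ be such that $C_{n+1}^{\mu+1/2}(t)+a\,C_n^{\mu+1/2}(t)$ has $n+1$ distinct zeros $t_{0,n},\dots,t_{n,n}$ in $(-1,1)$, and let $\lambda_{0,n},\dots,\lambda_{n,n}$ be the positive numbers such that $$\int_{-1}^1g(t)(1-t^2)^\mu dt=\sum_{j=0}^n\lambda_{j,n}\,g(t_{j,n})$$ for all polynomials $g$ of degree at most $2n$. For $f\in C(B^2)$ define $$\mathcal A_n^\mu(f;x,y)=\sum_{\nu=0}^n\sum_{j=0}^n\mathcal R_{\xi_\nu}^\mu(f;t_{j,n})\,T_{j,\nu}^\mu(x,y),\qquad T_{j,\nu}^\mu(x,y)=\frac{a_\mu\lambda_{j,n}}{n+1}(1-t_{j,n}^2)^{-\mu}\,\Phi_n^\mu(\xi_\nu,t_{j,n};x,y),$$ where $\xi_\nu=\frac{\nu\pi}{n+1}$. Then $\mathcal A_n^\mu$ is a projection operator onto the space $\Pi_n^2$ of polynomials in two variables of total degree at most $n$: $\mathcal A_n^\mu f\in\Pi_n^2$ for all $f$, and $\mathcal A_n^\mu P=P$ for all $P\in\Pi_n^2$.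
   Context: $B^2$ is the closed unit disk in $\mathbb R^2$; $W_\mu(x,y)=(1-x^2-y^2)^{\mu-1/2}$ on $B^2$; $a_\mu=(\mu+1/2)/\pi=1/\int_{B^2}W_\mu$; $\langle P,Q\rangle_\mu=a_\mu\int_{B^2}PQW_\mu\,dx\,dy$. $\mathcal V_k^2(W_\mu)$ is the space of polynomials in two variables of degree $k$ (together with $0$) that are orthogonal under $\langle\cdot,\cdot\rangle_\mu$ to all polynomials of total degree $<k$. Attenuated Radon projection: $$\mathcal R_\theta^\mu(f;t)=\int_{-\sqrt{1-t^2}}^{\sqrt{1-t^2}}f(t\cos\theta-s\sin\theta,\,t\sin\theta+s\cos\theta)\,(1-s^2-t^2)^{\mu-1/2}\,ds .$$ $(a)_k=a(a+1)\cdots(a+k-1)$. $C_k^\lambda$ is the Gegenbauer polynomial of degree $k$, orthogonal for $(1-s^2)^{\lambda-1/2}$ on $[-1,1]$, with $C_k^\lambda(1)=(2\lambda)_k/k!$. $p_l^{(\alpha,\beta)}$ is the Jacobi polynomial of degree $l$ with positive leading coefficient, orthonormal for the weight $(1-t)^\alpha(1+t)^\beta$ normalized to have integral $1$ on $[-1,1]$. Orthonormal basis of $\mathcal V_k^2(W_\mu)$: in polar coordinates $x=r\cos\phi$, $y=r\sin\phi$, $$P_{l,\varepsilon}^k(x,y)=h_{l,k}\,p_l^{(\mu-1/2,\,k-2l)}(2r^2-1)\,r^{k-2l}S_{k-2l,\varepsilon}(\phi),$$ where $S_{j,0}(\phi)=\cos j\phi$, $S_{j,1}(\phi)=\sin j\phi$,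 $0\le 2l\le k$ if $\varepsilon=0$, $0\le 2l\le k-1$ if $\varepsilon=1$, and $$h_{l,k}^2=\frac1{d_{l,k}}\,\frac{\Gamma(k-2l+\mu+3/2)}{\Gamma(\mu+3/2)\Gamma(k-2l+1)},\quad h_{l,k}>0,\qquad d_{l,k}=\tfrac12\ (2l<k),\quad d_{l,k}=1\ (2l=k).$$ $$\lambda_{l,k}^\mu=\frac{l!\,(k-l)!\,(k-l+\mu+\frac12)}{(\mu+\frac12)_l\,(\mu+\frac32)_{k-l}\,(k+\mu+\frac12)},\qquad D_k^{\mu+1/2}(\xi;x,y)=\sum_{l,\varepsilon}\lambda_{l,k}^\mu\,P_{l,\varepsilon}^k(\cos\xi,\sin\xi)\,P_{l,\varepsilon}^k(x,y)$$ (sum over all admissible pairs $(l,\varepsilon)$), and $$\Phi_n^\mu(\xi,t;x,y)=\sum_{k=0}^n\frac{k+\mu+1/2}{\mu+1/2}\,C_k^{\mu+1/2}(t)\,D_k^{\mu+1/2}(\xi;x,y).$$ (The constants $\lambda_{l,k}^\mu$ are unrelated to the quadrature weights $\lambda_{j,n}$.) *)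

theory Defs
  imports "HOL-Analysis.Analysis"
begin

definition unit_disk :: "(real \<times> real) set" where
  "unit_disk = {(x, y). x\<^sup>2 + y\<^sup>2 \<le> 1}"

(* Elements of Pi2 n are polynomial functions on the whole plane. *)
definition Pi2 :: "nat \<Rightarrow> (real \<times> real \<Rightarrow> real) set" where
  "Pi2 n = {P. \<exists>c :: nat \<Rightarrow> nat \<Rightarrow> real. \<forall>x y. P (x, y) = (\<Sum>i\<le>n. \<Sum>j\<le>n - i. c i j * x ^ i * y ^ j)}"

(* Constant making (1 - x^2 - y^2) powr (mu - 1/2) a probability density on the disk. *)
definition a_const :: "real \<Rightarrow> real" where
  "a_const \<mu> = (\<mu> + 1/2) / pi"

(* In the integrals below, the convention 0 powr 0 = 0 only affects the end points
   of the interval of integration. *)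

definition radon :: "real \<Rightarrow> real \<Rightarrow> (real \<times> real \<Rightarrow> real) \<Rightarrow> real \<Rightarrow> real" where
  "radon \<mu> \<theta> f t =
     (LBINT s:{- sqrt (1 - t\<^sup>2) .. sqrt (1 - t\<^sup>2)}.
        f (t * cos \<theta> - s * sin \<theta>, t * sin \<theta> + s * cos \<theta>) * (1 - s\<^sup>2 - t\<^sup>2) powr (\<mu> - 1/2))"

(* Well defined for lam > 0: an orthogonal polynomial for this weight is unique up to a
   scalar factor and does not vanish at 1. *)
definition gegenbauer :: "real \<Rightarrow> nat \<Rightarrow> real poly" where
  "gegenbauer lam k = (THE p. degree p = k \<and>
     (\<forall>q :: real poly. degree q < k \<longrightarrow>
        (LBINT s:{-1..1}. poly p s * poly q s * (1 - s\<^sup>2) powr (lam - 1/2)) = 0) \<and>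
     poly p 1 = pochhammer (2 * lam) k / fact k)"

definition jacobi_weight :: "real \<Rightarrow> real \<Rightarrow> real \<Rightarrow> real" where
  "jacobi_weight \<alpha> \<beta> t = (1 - t) powr \<alpha> * (1 + t) powr \<beta>"

definition jacobi_inner :: "real \<Rightarrow> real \<Rightarrow> real poly \<Rightarrow> real poly \<Rightarrow> real" where
  "jacobi_inner \<alpha> \<beta> p q =
     (LBINT t:{-1..1}. poly p t * poly q t * jacobi_weight \<alpha> \<beta> t) /
     (LBINT t:{-1..1}. jacobi_weight \<alpha> \<beta> t)"

(* Well defined for alpha, beta > -1. *)
definition jacobi_on :: "real \<Rightarrow> real \<Rightarrow> nat \<Rightarrow> real poly" where
  "jacobi_on \<alpha> \<beta> l = (THE p. degree p = l \<and> lead_coeff p > 0 \<and>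
     (\<forall>q. degree q < l \<longrightarrow> jacobi_inner \<alpha> \<beta> p q = 0) \<and> jacobi_inner \<alpha> \<beta> p p = 1)"

(* The index epsilon takes the values 0 and 1. *)
definition S_trig :: "nat \<Rightarrow> nat \<Rightarrow> real \<Rightarrow> real" where
  "S_trig j \<epsilon> \<phi> = (if \<epsilon> = 0 then cos (real j * \<phi>) else sin (real j * \<phi>))"

definition d_coef :: "nat \<Rightarrow> nat \<Rightarrow> real" where
  "d_coef l k = (if 2 * l < k then 1/2 else 1)"

definition h_coef :: "real \<Rightarrow> nat \<Rightarrow> nat \<Rightarrow> real" where
  "h_coef \<mu> l k = sqrt (1 / d_coef l k *
     (Gamma (real (k - 2 * l) + \<mu> + 3/2) / (Gamma (\<mu> + 3/2) * Gamma (real (k - 2 * l) + 1))))"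

(* For fixed k these are an orthonormal basis of the polynomials of degree k that are orthogonal
   to lower degrees for a_const mu * (1 - x^2 - y^2) powr (mu - 1/2) on the disk.
   At the origin the choice of the angle is irrelevant, because there either the power of r
   vanishes or k = 2 * l. *)
definition disk_basis :: "real \<Rightarrow> nat \<Rightarrow> nat \<Rightarrow> nat \<Rightarrow> real \<times> real \<Rightarrow> real" where
  "disk_basis \<mu> k l \<epsilon> = (\<lambda>(x, y).
     let r = sqrt (x\<^sup>2 + y\<^sup>2); \<phi> = Arg (Complex x y) in
       h_coef \<mu> l k * poly (jacobi_on (\<mu> - 1/2) (real (k - 2 * l)) l) (2 * r\<^sup>2 - 1) *
       r ^ (k - 2 * l) * S_trig (k - 2 * l) \<epsilon> \<phi>)"

definition lam_coef :: "real \<Rightarrow> nat \<Rightarrow> nat \<Rightarrow> real" where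
  "lam_coef \<mu> l k =
     (fact l * fact (k - l) * (real (k - l) + \<mu> + 1/2)) /
     (pochhammer (\<mu> + 1/2) l * pochhammer (\<mu> + 3/2) (k - l) * (real k + \<mu> + 1/2))"

(* 2 * l + eps <= k says 2l <= k for eps = 0 and 2l <= k - 1 for eps = 1. *)
definition admissible :: "nat \<Rightarrow> (nat \<times> nat) set" where
  "admissible k = {(l, \<epsilon>). \<epsilon> \<in> {0, 1} \<and> 2 * l + \<epsilon> \<le> k}"

(* D_ker mu k is the kernel D_k with upper index mu + 1/2. *)
definition D_ker :: "real \<Rightarrow> nat \<Rightarrow> real \<Rightarrow> real \<times> real \<Rightarrow> real" where
  "D_ker \<mu> k \<xi> z = (\<Sum>(l, \<epsilon>) \<in> admissible k.
     lam_coef \<mu> l k * disk_basis \<mu> k l \<epsilon> (cos \<xi>, sin \<xi>) * disk_basis \<mu> k l \<epsilon> z)"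

definition Phi_ker :: "real \<Rightarrow> nat \<Rightarrow> real \<Rightarrow> real \<Rightarrow> real \<times> real \<Rightarrow> real" where
  "Phi_ker \<mu> n \<xi> t z = (\<Sum>k\<le>n.
     (real k + \<mu> + 1/2) / (\<mu> + 1/2) * poly (gegenbauer (\<mu> + 1/2) k) t * D_ker \<mu> k \<xi> z)"

definition xi_angle :: "nat \<Rightarrow> nat \<Rightarrow> real" where
  "xi_angle n \<nu> = real \<nu> * pi / (real n + 1)"

(* t and w are the nodes and weights of the quadrature rule. *)
definition T_fun ::
  "real \<Rightarrow> nat \<Rightarrow> (nat \<Rightarrow> real) \<Rightarrow> (nat \<Rightarrow> real) \<Rightarrow> nat \<Rightarrow> nat \<Rightarrow> real \<times> real \<Rightarrow> real" where
  "T_fun \<mu> n t w j \<nu> z =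
     a_const \<mu> * w j / (real n + 1) * (1 - (t j)\<^sup>2) powr (- \<mu>) * Phi_ker \<mu> n (xi_angle n \<nu>) (t j) z"

definition A_op ::
  "real \<Rightarrow> nat \<Rightarrow> (nat \<Rightarrow> real) \<Rightarrow> (nat \<Rightarrow> real) \<Rightarrow> (real \<times> real \<Rightarrow> real) \<Rightarrow> real \<times> real \<Rightarrow> real" where
  "A_op \<mu> n t w f z =
     (\<Sum>\<nu>\<le>n. \<Sum>j\<le>n. radon \<mu> (xi_angle n \<nu>) f (t j) * T_fun \<mu> n t w j \<nu> z)"

end

(* A disk basis polynomial is P = h g(r^2) r^j S_j(phi) with j = k - 2l. Its projection in direction
   theta is (1 - t^2)^mu S_j(theta) q(t), where q has degree at most k. Orthogonality of P to lower
   degrees makes q orthogonal to all polynomials of degree < k for (1 - t^2)^mu, so q is a multiple of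
   C_k; the factor is read off at t = 1. In A_n P the quadrature rule, exact in degree 2n, then
   leaves only the summand D_k, and since cos and sin of frequencies j, j' <= n of equal parity are
   orthogonal on the n + 1 points xi_nu, the sum over nu leaves only P itself; lambda_{l,k} is the
   reciprocal of d_{l,k} h_{l,k}^2 p_l(1)^2. So A_n fixes the basis, which spans Pi_n. *)

theory Submission
  imports Defs
begin

section \<open>Integrals of polynomials against Jacobi weights\<close>

text \<open>The obstacle is the orthogonality of P to lower degrees: it is natural in polar
  coordinates, while the projection cuts the disk into parallel chords. No two-dimensional integral
  and no change to polar coordinates occurs. Polynomials in t and s are kept as
  \<open>real poly poly\<close>, and the disk integral is an iterated integral over chords, that is,
  a linear functional given by its moments. The moment recurrences treat both variables alike, which
  makes the functional vanish on the image of the rotation generator. Since (t + i s)^j is an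
  eigenvector of that generator, only frequency 0 has a nonzero integral, and radial polynomials
  reduce to the one-dimensional weight with exponents mu - 1/2 and 0. The Jacobi and Gegenbauer
  polynomials, given by definite descriptions, are multiples of hypergeometric polynomials with
  value 1 at 1; the uniqueness that identifies them also identifies q. Its value at 1 is accessible
  because the chord shrinks to a point there. The constant a_mu enters only as the reciprocal of the
  mass of the disk.\<close>

lemma jacobi_weight_nonneg: "0 \<le> jacobi_weight \<alpha> \<beta> t"
  by (simp add: jacobi_weight_def)

lemma jacobi_weight_pos: "-1 < t \<Longrightarrow> t < 1 \<Longrightarrow> 0 < jacobi_weight \<alpha> \<beta> t"
  by (simp add: jacobi_weight_def)

lemma borel_measurable_jacobi_weight [measurable]: "jacobi_weight \<alpha> \<beta> \<in> borel_measurable borel"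
  unfolding jacobi_weight_def by measurable

text \<open>The substitution t = 1 - 2x carries the weight to a multiple of Euler's integrand
  x^alpha (1 - x)^beta on [0, 1]. That integrand may be unbounded at the ends, so its Lebesgue
  integrability is taken from its gauge integral and its sign.\<close>

lemma jacobi_weight_Beta:
  assumes "\<alpha> > -1" "\<beta> > -1"
  shows set_integrable_jacobi_weight: "set_integrable lborel {-1..1} (jacobi_weight \<alpha> \<beta>)"
    and integral_jacobi_weight:
      "(LBINT t:{-1..1}. jacobi_weight \<alpha> \<beta> t) = 2 powr (\<alpha> + \<beta> + 1) * Beta (\<alpha> + 1) (\<beta> + 1)"
proof -
  define f where "f = (\<lambda>x::real. x powr \<alpha> * (1 - x) powr \<beta>)"
  define F where "F = (\<lambda>t. indicator {-1..1} t *\<^sub>R jacobi_weight \<alpha> \<beta> t)"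
  have hi: "(f has_integral Beta (\<alpha> + 1) (\<beta> + 1)) {0..1}"
    using has_integral_Beta_real[of "\<alpha> + 1" "\<beta> + 1"] assms by (simp add: f_def)
  then have "f absolutely_integrable_on {0..1}"
    by (intro nonnegative_absolutely_integrable_1) (auto simp: f_def)
  moreover have "(\<lambda>x. indicator {0..1} x *\<^sub>R f x) \<in> borel_measurable borel"
    unfolding f_def by measurable
  ultimately have int: "set_integrable lborel {0..1} f"
    unfolding set_integrable_def by (subst (asm) integrable_completion) auto
  have eq: "F (1 + (-2) * x) = 2 powr (\<alpha> + \<beta>) * (indicator {0..1} x *\<^sub>R f x)" for x
  proof (cases "x \<in> {0..1}")
    case True
    then have "(1 + (-2) * x) \<in> {-1..1}" by auto
    moreover have "jacobi_weight \<alpha> \<beta> (1 + (-2) * x) = (2 * x) powr \<alpha> * (2 * (1 - x)) powr \<beta>"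
      by (simp add: jacobi_weight_def algebra_simps)
    moreover have "\<dots> = 2 powr (\<alpha> + \<beta>) * f x"
      using True by (simp add: powr_mult powr_add f_def del: right_diff_distrib_numeral)
    ultimately show ?thesis using True by (simp add: F_def)
  qed (auto simp: F_def indicator_def)
  have "integrable lborel (\<lambda>x. F (1 + (-2) * x))"
    unfolding eq using int by (simp add: set_integrable_def)
  then show "set_integrable lborel {-1..1} (jacobi_weight \<alpha> \<beta>)"
    by (subst (asm) lborel_integrable_real_affine_iff) (auto simp: set_integrable_def F_def)
  have "(LBINT t:{-1..1}. jacobi_weight \<alpha> \<beta> t) = (\<integral>x. F x \<partial>lborel)"
    by (simp add: set_lebesgue_integral_def F_def)
  also have "\<dots> = 2 * (\<integral>x. F (1 + (-2) * x) \<partial>lborel)"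
    using lborel_integral_real_affine[of "-2" F 1] by simp
  also have "\<dots> = 2 * (2 powr (\<alpha> + \<beta>) * (LBINT x:{0..1}. f x))"
    unfolding eq by (simp add: set_lebesgue_integral_def)
  also have "(LBINT x:{0..1}. f x) = Beta (\<alpha> + 1) (\<beta> + 1)"
    using set_borel_integral_eq_integral(2)[OF int] hi by (simp add: integral_unique)
  finally show "(LBINT t:{-1..1}. jacobi_weight \<alpha> \<beta> t) = 2 powr (\<alpha> + \<beta> + 1) * Beta (\<alpha> + 1) (\<beta> + 1)"
    by (simp add: powr_add)
qed

text \<open>The weight may blow up at an end point, so the product need not be continuous there; it
  is enough that the other factor is bounded on the compact interval.\<close>

lemma set_integrable_continuous_times_weight:
  fixes g w :: "real \<Rightarrow> real"
  assumes "continuous_on {a..b} g" "set_integrable lborel {a..b} w"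
  shows "set_integrable lborel {a..b} (\<lambda>t. g t * w t)"
proof -
  obtain B where B: "\<And>t. t \<in> {a..b} \<Longrightarrow> norm (g t) \<le> B"
    using compact_imp_bounded[OF compact_continuous_image[OF assms(1) compact_Icc]]
    unfolding bounded_iff by blast
  have m: "(\<lambda>t. indicator {a..b} t *\<^sub>R g t) \<in> borel_measurable borel"
    using borel_measurable_continuous_on_indicator[OF _ assms(1)] by simp
  have "integrable lborel (\<lambda>t. (indicator {a..b} t *\<^sub>R g t) * (indicator {a..b} t *\<^sub>R w t))"
  proof (rule Bochner_Integration.integrable_bound)
    show "integrable lborel (\<lambda>t. B * (indicator {a..b} t *\<^sub>R w t))"
      using assms(2) by (simp add: set_integrable_def)
    show "(\<lambda>t. (indicator {a..b} t *\<^sub>R g t) * (indicator {a..b} t *\<^sub>R w t)) \<in> borel_measurable lborel"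
      using m assms(2) unfolding set_integrable_def
      by (intro borel_measurable_times) auto
    show "AE t in lborel. norm ((indicator {a..b} t *\<^sub>R g t) * (indicator {a..b} t *\<^sub>R w t))
            \<le> norm (B * (indicator {a..b} t *\<^sub>R w t))"
    proof (rule AE_I2)
      fix t
      show "norm ((indicator {a..b} t *\<^sub>R g t) * (indicator {a..b} t *\<^sub>R w t))
            \<le> norm (B * (indicator {a..b} t *\<^sub>R w t))"
        using B[of t] by (cases "t \<in> {a..b}") (auto simp: abs_mult intro!: mult_right_mono)
    qed
  qed
  moreover have "(\<lambda>t. (indicator {a..b} t *\<^sub>R g t) * (indicator {a..b} t *\<^sub>R w t)) =
      (\<lambda>t. indicator {a..b} t *\<^sub>R (g t * w t))"
    by (auto simp: indicator_def)
  ultimately show ?thesis by (simp add: set_integrable_def)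
qed

section \<open>Integration against a Jacobi weight as a linear functional on polynomials\<close>

lemma borel_measurable_poly [measurable]: "poly (p :: real poly) \<in> borel_measurable borel"
  by (intro borel_measurable_continuous_onI continuous_intros)

definition jacobi_int :: "real \<Rightarrow> real \<Rightarrow> real poly \<Rightarrow> real" where
  "jacobi_int \<alpha> \<beta> p = (LBINT t:{-1..1}. poly p t * jacobi_weight \<alpha> \<beta> t)"

lemma set_integrable_poly_jacobi_weight:
  assumes "\<alpha> > -1" "\<beta> > -1"
  shows "set_integrable lborel {-1..1} (\<lambda>t. poly p t * jacobi_weight \<alpha> \<beta> t)"
  by (intro set_integrable_continuous_times_weight set_integrable_jacobi_weight assms continuous_intros)

lemma jacobi_int_add:
  assumes "\<alpha> > -1" "\<beta> > -1"
  shows "jacobi_int \<alpha> \<beta> (p + q) = jacobi_int \<alpha> \<beta> p + jacobi_int \<alpha> \<beta> q"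
  unfolding jacobi_int_def using assms
  by (simp add: distrib_right set_integral_add set_integrable_poly_jacobi_weight)

lemma jacobi_int_smult: "jacobi_int \<alpha> \<beta> (smult c p) = c * jacobi_int \<alpha> \<beta> p"
  unfolding jacobi_int_def by (simp add: mult.assoc)

text \<open>The end points are a null set, so factors 1 - t and 1 + t need to be traded between
  polynomial and weight only where both are positive.\<close>

lemma jacobi_int_eqI:
  assumes "\<And>t. -1 < t \<Longrightarrow> t < 1 \<Longrightarrow>
    poly p t * jacobi_weight \<alpha> \<beta> t = c * (poly q t * jacobi_weight \<gamma> \<delta> t)"
  shows "jacobi_int \<alpha> \<beta> p = c * jacobi_int \<gamma> \<delta> q"
proof -
  have "AE t in lborel. t \<noteq> 1 \<and> t \<noteq> (-1::real)"
    using AE_lborel_singleton[of "1::real"] AE_lborel_singleton[of "-1::real"] by (auto elim: AE_mp)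
  then have "AE t in lborel. t \<in> {-1..1} \<longrightarrow>
      poly p t * jacobi_weight \<alpha> \<beta> t = c * (poly q t * jacobi_weight \<gamma> \<delta> t)"
    by eventually_elim (use assms in force)
  then have "jacobi_int \<alpha> \<beta> p = (LBINT t:{-1..1}. c * (poly q t * jacobi_weight \<gamma> \<delta> t))"
    unfolding jacobi_int_def by (intro set_lebesgue_integral_cong_AE) auto
  then show ?thesis by (simp add: jacobi_int_def)
qed

lemma jacobi_int_nonneg: "0 \<le> jacobi_int \<alpha> \<beta> (p * p)"
  unfolding jacobi_int_def set_lebesgue_integral_def
  by (intro integral_nonneg_AE AE_I2) (auto simp: jacobi_weight_nonneg)

text \<open>A nonnegative integrand with integral 0 vanishes almost everywhere. Off the finitely
  many roots of p it is positive on (-1, 1), so that interval would be a null set.\<close>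

lemma jacobi_int_definite:
  assumes ab: "\<alpha> > -1" "\<beta> > -1" and 0: "jacobi_int \<alpha> \<beta> (p * p) = 0"
  shows "p = 0"
proof (rule ccontr)
  assume "p \<noteq> 0"
  let ?f = "\<lambda>t. indicator {-1..1} t *\<^sub>R (poly (p * p) t * jacobi_weight \<alpha> \<beta> t)"
  have "integrable lborel ?f"
    using set_integrable_poly_jacobi_weight[OF ab, of "p * p"] by (simp only: set_integrable_def)
  then have "AE t in lborel. ?f t = 0"
    using 0 by (subst integral_nonneg_eq_0_iff_AE [symmetric])
      (auto simp: jacobi_int_def set_lebesgue_integral_def jacobi_weight_nonneg)
  moreover have "AE t in lborel. t \<notin> {t. poly p t = 0}"
    using \<open>p \<noteq> 0\<close> by (intro AE_not_in countable_imp_null_set_lborel countable_finite poly_roots_finite)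
  ultimately have "AE t in lborel. t \<notin> {-1<..<1::real}"
  proof eventually_elim
    case (elim t)
    show ?case
    proof
      assume "t \<in> {-1<..<1}"
      then show False using elim jacobi_weight_pos[of t \<alpha> \<beta>] by (auto simp: indicator_def)
    qed
  qed
  then have "emeasure lborel {t::real. -1 < t \<and> t < 1} = 0"
    by (subst (asm) AE_iff_measurable[OF _ refl]) auto
  moreover have "{t::real. -1 < t \<and> t < 1} = {-1<..<1}" by auto
  ultimately have "emeasure lborel {-1<..<1::real} = 0" by simp
  then show False by simp
qed

text \<open>The powers are absorbed into the exponents of the weight. Halving the linear factors
  keeps the power of 2 independent of i and m.\<close>

lemma jacobi_int_Beta:
  assumes "\<alpha> > -1" "\<beta> > -1"
  shows "jacobi_int \<alpha> \<beta> ([:1/2, -1/2:] ^ i * [:1/2, 1/2:] ^ m) =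
    2 powr (\<alpha> + \<beta> + 1) * Beta (\<alpha> + 1 + real i) (\<beta> + 1 + real m)"
proof -
  have "jacobi_int \<alpha> \<beta> ([:1/2, -1/2:] ^ i * [:1/2, 1/2:] ^ m) =
      (1 / 2 ^ (i + m)) * jacobi_int (\<alpha> + real i) (\<beta> + real m) 1"
  proof (rule jacobi_int_eqI)
    fix t :: real assume t: "-1 < t" "t < 1"
    have "poly ([:1/2, -1/2:] ^ i * [:1/2, 1/2:] ^ m) t = ((1 - t) / 2) ^ i * ((1 + t) / 2) ^ m"
      by (simp add: diff_divide_distrib add_divide_distrib)
    then have "poly ([:1/2, -1/2:] ^ i * [:1/2, 1/2:] ^ m) t = (1 - t) ^ i * (1 + t) ^ m / 2 ^ (i + m)"
      by (simp only: power_add power_divide) simp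
    then show "poly ([:1/2, -1/2:] ^ i * [:1/2, 1/2:] ^ m) t * jacobi_weight \<alpha> \<beta> t =
        1 / 2 ^ (i + m) * (poly 1 t * jacobi_weight (\<alpha> + real i) (\<beta> + real m) t)"
      using t by (simp add: jacobi_weight_def powr_add powr_realpow)
  qed
  also have "\<dots> = (1 / 2 ^ (i + m)) *
      (2 powr (\<alpha> + real i + (\<beta> + real m) + 1) * Beta (\<alpha> + real i + 1) (\<beta> + real m + 1))"
    using integral_jacobi_weight[of "\<alpha> + real i" "\<beta> + real m"] assms by (simp add: jacobi_int_def)
  also have "2 powr (\<alpha> + real i + (\<beta> + real m) + 1) = 2 powr (\<alpha> + \<beta> + 1) * 2 ^ (i + m)"
    by (simp add: powr_add powr_realpow power_add mult_ac)
  finally show ?thesis by (simp add: add_ac)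
qed

lemma jacobi_int_1:
  "\<alpha> > -1 \<Longrightarrow> \<beta> > -1 \<Longrightarrow> jacobi_int \<alpha> \<beta> 1 = 2 powr (\<alpha> + \<beta> + 1) * Beta (\<alpha> + 1) (\<beta> + 1)"
  using jacobi_int_Beta[of \<alpha> \<beta> 0 0] by simp

section \<open>Jacobi and Gegenbauer polynomials\<close>

text \<open>The hypergeometric form of the Jacobi polynomial, normalized to the value 1 at 1; the linear
  factor is (1 - t) / 2.\<close>
definition jacobi_hyp :: "real \<Rightarrow> real \<Rightarrow> nat \<Rightarrow> real poly" where
  "jacobi_hyp \<alpha> \<beta> l = (\<Sum>i\<le>l. smult (pochhammer (- real l) i * pochhammer (real l + \<alpha> + \<beta> + 1) i /
     (pochhammer (\<alpha> + 1) i * fact i)) ([:1/2, -1/2:] ^ i))"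

lemma degree_linear_power_le: "degree ([:a, b :: real:] ^ i) \<le> i"
  by (rule order.trans[OF degree_power_le]) auto

lemma coeff_linear_power_self: "coeff ([:a, b :: real:] ^ i) i = b ^ i"
proof (induction i)
  case (Suc i)
  have "coeff ([:a, b:] ^ i) (Suc i) = 0"
    by (rule coeff_eq_0) (use degree_linear_power_le[of a b i] in auto)
  with Suc show ?case by simp
qed simp

lemma poly_jacobi_hyp_1 [simp]: "poly (jacobi_hyp \<alpha> \<beta> l) 1 = 1"
  unfolding jacobi_hyp_def poly_sum by (subst sum.atMost_shift) simp

lemma degree_jacobi_hyp_le: "degree (jacobi_hyp \<alpha> \<beta> l) \<le> l"
  unfolding jacobi_hyp_def
  by (intro degree_sum_le order.trans[OF degree_smult_le] order.trans[OF degree_linear_power_le]) auto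

lemma coeff_jacobi_hyp:
  "coeff (jacobi_hyp \<alpha> \<beta> l) l =
     pochhammer (real l + \<alpha> + \<beta> + 1) l / pochhammer (\<alpha> + 1) l / 2 ^ l"
proof -
  have "coeff (jacobi_hyp \<alpha> \<beta> l) l = (\<Sum>i\<in>{l}. pochhammer (- real l) i * pochhammer (real l + \<alpha> + \<beta> + 1) i /
     (pochhammer (\<alpha> + 1) i * fact i) * coeff ([:1/2, -1/2:] ^ i) l)"
    unfolding jacobi_hyp_def coeff_sum coeff_smult
  proof (rule sum.mono_neutral_right)
    show "\<forall>i\<in>{..l} - {l}. pochhammer (- real l) i * pochhammer (real l + \<alpha> + \<beta> + 1) i /
        (pochhammer (\<alpha> + 1) i * fact i) * coeff ([:1/2, -1/2:] ^ i) l = 0"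
      using le_less_trans[OF degree_linear_power_le] by (auto intro!: coeff_eq_0)
  qed auto
  also have "\<dots> = pochhammer (real l + \<alpha> + \<beta> + 1) l / pochhammer (\<alpha> + 1) l * ((-1) ^ l * (-1/2) ^ l)"
    by (simp add: coeff_linear_power_self pochhammer_same)
  also have "(-1) ^ l * (-1/2) ^ l = (1 / 2 ^ l :: real)"
    by (simp add: power_mult_distrib [symmetric] power_one_over)
  finally show ?thesis by simp
qed

lemma pochhammer_shift_pos: "\<alpha> > -1 \<Longrightarrow> pochhammer (\<alpha> + 1 :: real) i > 0"
  by (intro pochhammer_pos) auto

lemma coeff_jacobi_hyp_pos:
  assumes "\<alpha> > -1" "\<beta> > -1"
  shows "coeff (jacobi_hyp \<alpha> \<beta> l) l > 0"
proof -
  \<comment> \<open>Here alpha + beta + 1 may be negative, which is harmless for l = 0, where the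
    product is empty; for l > 0 the first factor is already positive.\<close>
  have "pochhammer (real l + \<alpha> + \<beta> + 1) l > 0"
    using assms by (cases l) (auto intro!: pochhammer_pos)
  then show ?thesis
    unfolding coeff_jacobi_hyp using pochhammer_shift_pos[OF assms(1)] by simp
qed

lemma degree_jacobi_hyp: "\<alpha> > -1 \<Longrightarrow> \<beta> > -1 \<Longrightarrow> degree (jacobi_hyp \<alpha> \<beta> l) = l"
  using coeff_jacobi_hyp_pos[of \<alpha> \<beta> l] degree_jacobi_hyp_le[of \<alpha> \<beta> l]
  by (metis antisym le_degree less_irrefl)

lemma Beta_add_nat_left:
  assumes "x > 0" "y > (0 :: real)"
  shows "Beta (x + real i) y = pochhammer x i / pochhammer (x + y) i * Beta x y"
proof (induction i)
  case (Suc i)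
  have "(x + real i + y) * Beta (x + real i + 1) y = (x + real i) * Beta (x + real i) y"
    using assms by (intro Beta_plus1_left) (auto dest: nonpos_Ints_nonpos)
  then have "Beta (x + real (Suc i)) y = (x + real i) / (x + real i + y) * Beta (x + real i) y"
    using assms by (simp add: field_simps)
  then show ?case using assms by (simp add: Suc pochhammer_Suc add_ac mult_ac)
qed simp

lemma jacobi_int_sum:
  assumes "\<alpha> > -1" "\<beta> > -1"
  shows "jacobi_int \<alpha> \<beta> (\<Sum>i\<in>I. f i) = (\<Sum>i\<in>I. jacobi_int \<alpha> \<beta> (f i))"
  by (induction I rule: infinite_finite_induct)
    (auto simp: jacobi_int_add assms jacobi_int_smult[of _ _ 0 0, simplified])

lemma jacobi_int_diff:
  assumes "\<alpha> > -1" "\<beta> > -1"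
  shows "jacobi_int \<alpha> \<beta> (p - q) = jacobi_int \<alpha> \<beta> p - jacobi_int \<alpha> \<beta> q"
  using jacobi_int_add[OF assms, of p "smult (-1) q"] jacobi_int_smult[of \<alpha> \<beta> "-1" q] by simp

text \<open>Testing against powers of (1 + t) / 2 turns the integral into a Chu-Vandermonde sum.\<close>
lemma jacobi_int_hyp_power:
  assumes ab: "\<alpha> > -1" "\<beta> > -1"
  shows "jacobi_int \<alpha> \<beta> (jacobi_hyp \<alpha> \<beta> l * [:1/2, 1/2:] ^ m) =
    2 powr (\<alpha> + \<beta> + 1) * Beta (\<alpha> + 1) (\<beta> + 1 + real m) *
    (pochhammer (real m + 1 - real l) l / pochhammer (\<alpha> + \<beta> + real m + 2) l)"
proof -
  let ?c = "\<alpha> + \<beta> + real m + 2"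
  let ?B = "2 powr (\<alpha> + \<beta> + 1) * Beta (\<alpha> + 1) (\<beta> + 1 + real m)"
  have "jacobi_int \<alpha> \<beta> (jacobi_hyp \<alpha> \<beta> l * [:1/2, 1/2:] ^ m) =
    (\<Sum>i\<le>l. pochhammer (- real l) i * pochhammer (real l + \<alpha> + \<beta> + 1) i /
     (pochhammer (\<alpha> + 1) i * fact i) * jacobi_int \<alpha> \<beta> ([:1/2, -1/2:] ^ i * [:1/2, 1/2:] ^ m))"
    by (simp add: jacobi_hyp_def sum_distrib_right jacobi_int_sum[OF ab] jacobi_int_smult)
  also have "\<dots> = (\<Sum>i\<le>l. ?B * (pochhammer (real l + \<alpha> + \<beta> + 1) i * pochhammer (- real l) i /
      (fact i * pochhammer ?c i)))"
  proof (rule sum.cong[OF refl])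
    fix i
    have "\<alpha> + 1 + (\<beta> + 1 + real m) = ?c" by simp
    with Beta_add_nat_left[of "\<alpha> + 1" "\<beta> + 1 + real m" i] ab
    have "Beta (\<alpha> + 1 + real i) (\<beta> + 1 + real m) =
        pochhammer (\<alpha> + 1) i / pochhammer ?c i * Beta (\<alpha> + 1) (\<beta> + 1 + real m)" by simp
    then show "pochhammer (- real l) i * pochhammer (real l + \<alpha> + \<beta> + 1) i /
       (pochhammer (\<alpha> + 1) i * fact i) * jacobi_int \<alpha> \<beta> ([:1/2, -1/2:] ^ i * [:1/2, 1/2:] ^ m) =
       ?B * (pochhammer (real l + \<alpha> + \<beta> + 1) i * pochhammer (- real l) i / (fact i * pochhammer ?c i))"
      using pochhammer_shift_pos[OF ab(1), of i] unfolding jacobi_int_Beta[OF ab] by simp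
  qed
  also have "\<dots> = ?B * (\<Sum>i=0..l. pochhammer (real l + \<alpha> + \<beta> + 1) i * pochhammer (- of_nat l) i /
      (of_nat (fact i) * pochhammer ?c i))"
    by (simp add: sum_distrib_left atLeast0AtMost)
  also have "(\<Sum>i=0..l. pochhammer (real l + \<alpha> + \<beta> + 1) i * pochhammer (- of_nat l) i /
      (of_nat (fact i) * pochhammer ?c i)) = pochhammer (?c - (real l + \<alpha> + \<beta> + 1)) l / pochhammer ?c l"
    using ab by (intro Vandermonde_pochhammer) auto
  also have "?c - (real l + \<alpha> + \<beta> + 1) = real m + 1 - real l" by simp
  finally show ?thesis .
qed

text \<open>The maps u = (1 + t) / 2 and t = 2u - 1 are inverse to each other, so expanding q(2u -
  1) in powers of u expands q in the test functions of the Chu-Vandermonde computation.\<close>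

lemma linear_power_basis:
  fixes q :: "real poly"
  shows "q = (\<Sum>m\<le>degree q. smult (coeff (pcompose q [:-1, 2:]) m) ([:1/2, 1/2:] ^ m))"
proof -
  have "q = pcompose (pcompose q [:-1, 2:]) [:1/2, 1/2:]"
    by (simp add: pcompose_assoc [symmetric] pcompose_pCons pcompose_idR)
  also have "\<dots> = (\<Sum>m\<le>degree (pcompose q [:-1, 2:]). smult (coeff (pcompose q [:-1, 2:]) m) ([:1/2, 1/2:] ^ m))"
    by (simp add: pcompose_altdef poly_altdef degree_map_poly coeff_map_poly)
  finally show ?thesis by (simp add: degree_pcompose)
qed

text \<open>The factors of the Pochhammer symbol (m + 1 - l)_l run from m + 1 - l to m, hence pass
  through 0 when m < l.\<close>

lemma jacobi_hyp_orthogonal: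
  assumes ab: "\<alpha> > -1" "\<beta> > -1" and q: "degree q < l"
  shows "jacobi_int \<alpha> \<beta> (jacobi_hyp \<alpha> \<beta> l * q) = 0"
proof -
  have "jacobi_int \<alpha> \<beta> (jacobi_hyp \<alpha> \<beta> l * [:1/2, 1/2:] ^ m) = 0" if "m < l" for m
  proof -
    have "real m + 1 - real l = - of_nat (l - m - 1)" using that by simp
    then have "pochhammer (real m + 1 - real l) l = 0"
      using that unfolding pochhammer_eq_0_iff by (intro exI[of _ "l - m - 1"]) auto
    then show ?thesis by (simp add: jacobi_int_hyp_power[OF ab])
  qed
  then show ?thesis using q
    by (subst linear_power_basis[of q]) (simp add: sum_distrib_left jacobi_int_sum[OF ab] jacobi_int_smult)
qed

text \<open>For l = 0 the remainder after cancelling the leading term is the zero polynomial, whose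
  \<open>degree\<close> is 0 and not less than l; hence the disjunction.\<close>

lemma degree_less_or_0:
  fixes r :: "real poly"
  assumes "degree r \<le> l" "coeff r l = 0"
  shows "r = 0 \<or> degree r < l"
  using assms by (metis eq_zero_or_degree_less)

text \<open>Subtracting the multiple of \<open>jacobi_hyp\<close> with the same leading coefficient
  leaves a remainder of lower degree that is orthogonal to itself. The factor is then expressed as
  the value at 1, so that later uses need no leading coefficients.\<close>

lemma jacobi_orthogonal_unique:
  assumes ab: "\<alpha> > -1" "\<beta> > -1" and p: "degree p \<le> l"
    and orth: "\<And>q. degree q < l \<Longrightarrow> jacobi_int \<alpha> \<beta> (p * q) = 0"
  shows "p = smult (poly p 1) (jacobi_hyp \<alpha> \<beta> l)"
proof -
  define c where "c = coeff p l / coeff (jacobi_hyp \<alpha> \<beta> l) l"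
  define r where "r = p - smult c (jacobi_hyp \<alpha> \<beta> l)"
  have "degree r \<le> l"
    unfolding r_def using p degree_jacobi_hyp[OF ab]
    by (intro degree_diff_le order.trans[OF degree_smult_le]) auto
  moreover have "coeff r l = 0"
    using coeff_jacobi_hyp_pos[OF ab, of l] by (simp add: r_def c_def)
  ultimately consider "r = 0" | "degree r < l" using degree_less_or_0 by blast
  then have "r = 0"
  proof cases
    case 2
    have "jacobi_int \<alpha> \<beta> (r * r) = jacobi_int \<alpha> \<beta> (p * r) - c * jacobi_int \<alpha> \<beta> (jacobi_hyp \<alpha> \<beta> l * r)"
      by (subst (1) r_def) (simp add: left_diff_distrib jacobi_int_diff[OF ab] jacobi_int_smult)
    also have "\<dots> = 0" by (simp add: orth 2 jacobi_hyp_orthogonal[OF ab])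
    finally show ?thesis by (rule jacobi_int_definite[OF ab])
  qed
  then have *: "p = smult c (jacobi_hyp \<alpha> \<beta> l)" by (simp add: r_def)
  then have "poly p 1 = c" by simp
  with * show ?thesis by simp
qed

text \<open>The squared norm of \<^const>\<open>jacobi_hyp\<close> for the weight of total mass 1.\<close>
definition jacobi_norm :: "real \<Rightarrow> real \<Rightarrow> nat \<Rightarrow> real" where
  "jacobi_norm \<alpha> \<beta> l = fact l * pochhammer (\<beta> + 1) l * (\<alpha> + \<beta> + real l + 1) /
     (pochhammer (\<alpha> + 1) l * pochhammer (\<alpha> + \<beta> + 2) l * (\<alpha> + \<beta> + 2 * real l + 1))"

lemma jacobi_norm_pos:
  assumes "\<alpha> > -1" "\<beta> > -1" "\<alpha> + \<beta> > -1"
  shows "jacobi_norm \<alpha> \<beta> l > 0"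
  unfolding jacobi_norm_def using assms
  by (intro divide_pos_pos mult_pos_pos pochhammer_pos) auto

text \<open>By orthogonality one of the two factors may be replaced by its leading term in powers of
  (1 + t) / 2. \<open>K\<close> is that leading coefficient, and the case m = l of the
  Chu-Vandermonde formula remains.\<close>

lemma jacobi_int_hyp_square:
  assumes ab: "\<alpha> > -1" "\<beta> > -1" and s: "\<alpha> + \<beta> > -1"
  shows "jacobi_int \<alpha> \<beta> (jacobi_hyp \<alpha> \<beta> l * jacobi_hyp \<alpha> \<beta> l) =
    jacobi_norm \<alpha> \<beta> l * jacobi_int \<alpha> \<beta> 1"
proof -
  let ?p = "jacobi_hyp \<alpha> \<beta> l"
  define K where "K = pochhammer (real l + \<alpha> + \<beta> + 1) l / pochhammer (\<alpha> + 1) l"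
  define r where "r = ?p - smult K ([:1/2, 1/2:] ^ l)"
  have "degree r \<le> l"
    unfolding r_def using degree_jacobi_hyp_le degree_linear_power_le
    by (intro degree_diff_le order.trans[OF degree_smult_le]) auto
  moreover have "coeff r l = 0"
    by (simp add: r_def K_def coeff_jacobi_hyp coeff_linear_power_self power_one_over)
  ultimately have "jacobi_int \<alpha> \<beta> (?p * r) = 0"
    using degree_less_or_0[of r l] jacobi_hyp_orthogonal[OF ab, of r l]
    by (auto simp: jacobi_int_smult[of _ _ 0 0, simplified])
  then have "jacobi_int \<alpha> \<beta> (?p * ?p) = K * jacobi_int \<alpha> \<beta> (?p * [:1/2, 1/2:] ^ l)"
    by (simp add: r_def right_diff_distrib jacobi_int_diff[OF ab] jacobi_int_smult)
  also have "\<dots> = K * (2 powr (\<alpha> + \<beta> + 1) * Beta (\<alpha> + 1) (\<beta> + 1 + real l) *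
      (fact l / pochhammer (\<alpha> + \<beta> + real l + 2) l))"
    by (simp add: jacobi_int_hyp_power[OF ab] pochhammer_fact [symmetric])
  also have "Beta (\<alpha> + 1) (\<beta> + 1 + real l) =
      pochhammer (\<beta> + 1) l / pochhammer (\<alpha> + \<beta> + 2) l * Beta (\<alpha> + 1) (\<beta> + 1)"
    using Beta_add_nat_left[of "\<beta> + 1" "\<alpha> + 1" l] ab by (simp add: Beta_commute add_ac)
  also have "pochhammer (\<alpha> + \<beta> + real l + 2) l =
      pochhammer (real l + \<alpha> + \<beta> + 1) l * (\<alpha> + \<beta> + 2 * real l + 1) / (\<alpha> + \<beta> + real l + 1)"
  proof -
    let ?z = "\<alpha> + \<beta> + real l + 1"
    have "?z * pochhammer (?z + 1) l = pochhammer ?z l * (?z + real l)"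
      using pochhammer_rec[of ?z l] pochhammer_rec'[of ?z l] by (simp add: mult_ac)
    then show ?thesis using s by (simp add: field_simps)
  qed
  also have "K * (2 powr (\<alpha> + \<beta> + 1) *
      (pochhammer (\<beta> + 1) l / pochhammer (\<alpha> + \<beta> + 2) l * Beta (\<alpha> + 1) (\<beta> + 1)) *
      (fact l / (pochhammer (real l + \<alpha> + \<beta> + 1) l * (\<alpha> + \<beta> + 2 * real l + 1) / (\<alpha> + \<beta> + real l + 1))))
    = jacobi_norm \<alpha> \<beta> l * (2 powr (\<alpha> + \<beta> + 1) * Beta (\<alpha> + 1) (\<beta> + 1))"
  proof -
    have "pochhammer (real l + \<alpha> + \<beta> + 1) l > 0"
      using s by (intro pochhammer_pos) auto
    then show ?thesis unfolding K_def jacobi_norm_def by (simp add: mult_ac)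
  qed
  finally show ?thesis by (simp add: jacobi_int_1[OF ab])
qed

text \<open>Orthogonality forces a multiple of \<open>jacobi_hyp\<close>; the norm determines the
  square of the factor and the sign of the leading coefficient selects the root.\<close>

lemma jacobi_on_eq:
  assumes ab: "\<alpha> > -1" "\<beta> > -1" and s: "\<alpha> + \<beta> > -1"
  shows "jacobi_on \<alpha> \<beta> l = smult (1 / sqrt (jacobi_norm \<alpha> \<beta> l)) (jacobi_hyp \<alpha> \<beta> l)"
proof -
  let ?p = "jacobi_hyp \<alpha> \<beta> l" and ?N = "jacobi_norm \<alpha> \<beta> l"
  have inner: "jacobi_inner \<alpha> \<beta> p q = jacobi_int \<alpha> \<beta> (p * q) / jacobi_int \<alpha> \<beta> 1" for p q
    by (simp add: jacobi_inner_def jacobi_int_def mult.assoc)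
  have orth: "jacobi_int \<alpha> \<beta> (q * ?p) = 0" if "degree q < l" for q
    using jacobi_hyp_orthogonal[OF ab that] by (simp add: mult.commute)
  have N: "?N > 0" by (rule jacobi_norm_pos[OF ab s])
  have 1: "jacobi_int \<alpha> \<beta> 1 > 0"
    using jacobi_int_nonneg[of \<alpha> \<beta> 1] jacobi_int_definite[OF ab, of 1] by fastforce
  show ?thesis unfolding jacobi_on_def
  proof (rule the_equality)
    show "degree (smult (1 / sqrt ?N) ?p) = l \<and> lead_coeff (smult (1 / sqrt ?N) ?p) > 0 \<and>
        (\<forall>q. degree q < l \<longrightarrow> jacobi_inner \<alpha> \<beta> (smult (1 / sqrt ?N) ?p) q = 0) \<and>
        jacobi_inner \<alpha> \<beta> (smult (1 / sqrt ?N) ?p) (smult (1 / sqrt ?N) ?p) = 1"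
      using N 1 coeff_jacobi_hyp_pos[OF ab, of l]
      by (auto simp: inner degree_jacobi_hyp[OF ab] jacobi_int_smult orth
          jacobi_int_hyp_square[OF ab s] field_simps)
  next
    fix p assume p: "degree p = l \<and> lead_coeff p > 0 \<and>
      (\<forall>q. degree q < l \<longrightarrow> jacobi_inner \<alpha> \<beta> p q = 0) \<and> jacobi_inner \<alpha> \<beta> p p = 1"
    define c where "c = poly p 1"
    have pc: "p = smult c ?p"
      unfolding c_def by (rule jacobi_orthogonal_unique[OF ab]) (use p 1 in \<open>auto simp: inner\<close>)
    have "jacobi_inner \<alpha> \<beta> p p = c\<^sup>2 * ?N"
      unfolding pc inner using 1 by (simp add: jacobi_int_smult jacobi_int_hyp_square[OF ab s] power2_eq_square)
    moreover have "c > 0"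
      using p coeff_jacobi_hyp_pos[OF ab, of l]
      by (subst (asm) (2) pc) (auto simp: degree_jacobi_hyp[OF ab] zero_less_mult_iff)
    ultimately have "c = 1 / sqrt ?N"
      using p N by (metis (no_types) abs_of_pos nonzero_eq_divide_eq order_less_irrefl real_sqrt_abs real_sqrt_divide real_sqrt_one)
    then show "p = smult (1 / sqrt ?N) ?p" using pc by simp
  qed
qed

lemma one_minus_square_powr:
  "s \<in> {-1..1} \<Longrightarrow> (1 - s\<^sup>2) powr \<nu> = jacobi_weight \<nu> \<nu> s"
  by (simp add: jacobi_weight_def powr_mult [symmetric] power2_eq_square algebra_simps)

lemma gegenbauer_int_eq:
  "(LBINT s:{-1..1}. poly p s * (1 - s\<^sup>2) powr \<nu>) = jacobi_int \<nu> \<nu> p"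
  unfolding jacobi_int_def
  by (intro set_lebesgue_integral_cong) (auto simp: one_minus_square_powr)

lemma gegenbauer_eq:
  assumes "lam > 0"
  shows "gegenbauer lam k = smult (pochhammer (2 * lam) k / fact k) (jacobi_hyp (lam - 1/2) (lam - 1/2) k)"
proof -
  let ?\<alpha> = "lam - 1/2"
  have ab: "?\<alpha> > -1" using assms by simp
  have int: "(LBINT s:{-1..1}. poly p s * poly q s * (1 - s\<^sup>2) powr ?\<alpha>) = jacobi_int ?\<alpha> ?\<alpha> (p * q)" for p q
    using gegenbauer_int_eq[of "p * q" ?\<alpha>] by simp
  have pos: "pochhammer (2 * lam) k > 0" using assms by (intro pochhammer_pos) auto
  show ?thesis unfolding gegenbauer_def int
  proof (rule the_equality, goal_cases)
    case 1
    then show ?case using pos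
      by (auto simp: degree_jacobi_hyp[OF ab ab] jacobi_int_smult jacobi_hyp_orthogonal[OF ab ab])
  next
    case (2 p)
    then show ?case using jacobi_orthogonal_unique[OF ab ab, of p k] by auto
  qed
qed

section \<open>Bivariate polynomials and their moments over the disk\<close>

definition moment :: "real \<Rightarrow> nat \<Rightarrow> real" where
  "moment \<nu> i = jacobi_int \<nu> \<nu> (monom 1 i)"

text \<open>The integrand is the derivative of p(t) (1 - t^2)^(nu + 1), which vanishes at both ends
  because nu + 1 > 0.\<close>

lemma jacobi_int_pearson:
  assumes "\<nu> > -1"
  shows "jacobi_int \<nu> \<nu> (pderiv p * [:1, 0, -1:] - smult (2 * (\<nu> + 1)) (p * [:0, 1:])) = 0"
proof -
  let ?q = "pderiv p * [:1, 0, -1:] - smult (2 * (\<nu> + 1)) (p * [:0, 1:])"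
  let ?f = "\<lambda>t. poly p t * (1 - t\<^sup>2) powr (\<nu> + 1)"
  have "((\<lambda>t. poly ?q t * jacobi_weight \<nu> \<nu> t) has_integral (?f 1 - ?f (-1))) {-1..1}"
  proof (rule fundamental_theorem_of_calculus_interior)
    show "continuous_on {-1..1} ?f"
      using assms by (intro continuous_intros continuous_on_powr') (auto simp: abs_square_le_1 abs_le_iff)
  next
    fix t :: real assume t: "t \<in> {-1<..<1}"
    then have pos: "1 - t\<^sup>2 > 0" by (simp add: abs_square_less_1 abs_less_iff)
    have "(?f has_field_derivative (poly (pderiv p) t * (1 - t\<^sup>2) powr (\<nu> + 1) +
        poly p t * ((\<nu> + 1) * (1 - t\<^sup>2) powr \<nu> * (- (2 * t))))) (at t)"
      using pos by (auto intro!: derivative_eq_intros simp: algebra_simps)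
    also have "poly (pderiv p) t * (1 - t\<^sup>2) powr (\<nu> + 1) +
        poly p t * ((\<nu> + 1) * (1 - t\<^sup>2) powr \<nu> * (- (2 * t))) = poly ?q t * jacobi_weight \<nu> \<nu> t"
      using pos t by (simp add: powr_add one_minus_square_powr [symmetric] power2_eq_square algebra_simps)
    finally show "(?f has_vector_derivative poly ?q t * jacobi_weight \<nu> \<nu> t) (at t)"
      by (simp add: has_real_derivative_iff_has_vector_derivative)
  qed auto
  moreover have "?f 1 - ?f (-1) = 0" by simp
  ultimately show ?thesis
    using set_borel_integral_eq_integral(2)[OF set_integrable_poly_jacobi_weight[OF assms assms], of ?q]
    by (simp add: jacobi_int_def integral_unique)
qed

lemma jacobi_int_raise:
  "jacobi_int (\<nu> + 1) (\<nu> + 1) p = jacobi_int \<nu> \<nu> (p * [:1, 0, -1:])"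
proof -
  have "jacobi_int (\<nu> + 1) (\<nu> + 1) p = 1 * jacobi_int \<nu> \<nu> (p * [:1, 0, -1:])"
    by (rule jacobi_int_eqI) (simp add: jacobi_weight_def powr_add algebra_simps)
  then show ?thesis by simp
qed

lemma jacobi_int_raise_power:
  "jacobi_int (\<nu> + real m) (\<nu> + real m) p = jacobi_int \<nu> \<nu> (p * [:1, 0, -1:] ^ m)"
proof (induction m arbitrary: p)
  case (Suc m)
  have "jacobi_int (\<nu> + real (Suc m)) (\<nu> + real (Suc m)) p =
      jacobi_int (\<nu> + real m + 1) (\<nu> + real m + 1) p" by (simp add: add_ac)
  also have "\<dots> = jacobi_int \<nu> \<nu> (p * [:1, 0, -1:] * [:1, 0, -1:] ^ m)"
    unfolding jacobi_int_raise Suc.IH ..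
  finally show ?case by (simp only: power_Suc mult.assoc)
qed simp

lemma monom_times_weight: "monom 1 i * [:1, 0, -1:] = monom 1 i - monom (1 :: real) (i + 2)"
proof -
  have "[:1, 0, -1:] = 1 - monom (1 :: real) 2"
    by (simp add: monom_altdef power2_eq_square one_pCons)
  then show ?thesis by (simp add: right_diff_distrib mult_monom)
qed

lemma moment_raise: "\<nu> > -1 \<Longrightarrow> moment (\<nu> + 1) i = moment \<nu> i - moment \<nu> (i + 2)"
  unfolding moment_def jacobi_int_raise monom_times_weight by (rule jacobi_int_diff)

text \<open>This is the preceding integration by parts for p = t^(i + 1): with m_i the moment of
  order i, it reads (i + 1) (m_i - m_(i+2)) = 2 (nu + 1) m_(i+2).\<close>

lemma moment_step:
  assumes "\<nu> > -1"
  shows "(real i + 2 * \<nu> + 3) * moment \<nu> (i + 2) = (real i + 1) * moment \<nu> i"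
proof -
  have "pderiv (monom 1 (Suc i)) * [:1, 0, -1:] = smult (real i + 1) (monom 1 i * [:1, 0, -1:])"
    by (simp only: pderiv_monom mult_smult_left [symmetric] smult_monom) (simp add: add.commute)
  moreover have "monom 1 (Suc i) * [:0, 1:] = monom (1 :: real) (i + 2)"
    by (simp add: monom_Suc)
  ultimately have "jacobi_int \<nu> \<nu> (smult (real i + 1) (monom 1 i - monom 1 (i + 2)) -
      smult (2 * (\<nu> + 1)) (monom 1 (i + 2))) = 0"
    using jacobi_int_pearson[OF assms, of "monom 1 (Suc i)"] by (simp only: monom_times_weight)
  then show ?thesis
    by (simp add: jacobi_int_diff assms jacobi_int_smult moment_def algebra_simps)
qed

lemma moment_odd:
  assumes "\<nu> > -1" "odd i"
  shows "moment \<nu> i = 0"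
  using \<open>odd i\<close>
proof (induction i rule: nat_induct2)
  case 1
  \<comment> \<open>Integration by parts with p = 1 leaves only the term -2 (nu + 1) t.\<close>
  have "- (2 * (\<nu> + 1)) * moment \<nu> 1 = 0"
    using jacobi_int_pearson[OF assms(1), of 1] jacobi_int_smult[of \<nu> \<nu> "- (2 * (\<nu> + 1))" "[:0, 1:]"]
    by (simp add: moment_def monom_altdef)
  then show ?case using assms(1) by simp
next
  case (step i)
  then show ?case using moment_step[OF assms(1), of i] assms(1) by auto
qed auto

text \<open>A polynomial in t and s is a polynomial in s whose coefficients are polynomials in t.\<close>
abbreviation "bX \<equiv> [:[:0, 1 :: real:]:]"
abbreviation "bY \<equiv> [:0, 1 :: real poly:]"
definition bRho :: "real poly poly" where "bRho = bX * bX + bY * bY"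

definition bieval :: "real \<Rightarrow> real \<Rightarrow> real poly poly \<Rightarrow> real" where
  "bieval t s F = poly (poly F [:s:]) t"

lemma bieval_simps [simp]:
  "bieval t s (F + G) = bieval t s F + bieval t s G"
  "bieval t s (F - G) = bieval t s F - bieval t s G"
  "bieval t s (F * G) = bieval t s F * bieval t s G"
  "bieval t s (F ^ k) = bieval t s F ^ k"
  "bieval t s (pCons f F) = poly f t + s * bieval t s F"
  "bieval t s (smult f F) = poly f t * bieval t s F"
  "bieval t s 0 = 0" "bieval t s 1 = 1"
  by (simp_all add: bieval_def)

text \<open>A bound on the total degree, phrased through coefficients because \<open>degree\<close>
  of a nested polynomial counts the powers of s alone.\<close>

definition bidegree_le :: "nat \<Rightarrow> real poly poly \<Rightarrow> bool" where
  "bidegree_le N F \<longleftrightarrow> (\<forall>i j. coeff (coeff F j) i \<noteq> 0 \<longrightarrow> i + j \<le> N)"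

lemma bidegree_le_add: "bidegree_le N F \<Longrightarrow> bidegree_le N G \<Longrightarrow> bidegree_le N (F + G)"
  unfolding bidegree_le_def by (metis add.right_neutral coeff_add)

lemma bidegree_le_diff: "bidegree_le N F \<Longrightarrow> bidegree_le N G \<Longrightarrow> bidegree_le N (F - G)"
  unfolding bidegree_le_def by (metis diff_0_right coeff_diff)

lemma bidegree_le_mono: "bidegree_le N F \<Longrightarrow> N \<le> N' \<Longrightarrow> bidegree_le N' F"
  unfolding bidegree_le_def by (meson order.trans)

lemma bidegree_le_bX: "bidegree_le N F \<Longrightarrow> bidegree_le (Suc N) (bX * F)"
  by (auto simp: bidegree_le_def coeff_pCons split: nat.splits)

lemma bidegree_le_bY: "bidegree_le N F \<Longrightarrow> bidegree_le (Suc N) (bY * F)"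
  by (auto simp: bidegree_le_def coeff_pCons split: nat.splits)

lemma bidegree_le_bRho: "bidegree_le N F \<Longrightarrow> bidegree_le (N + 2) (bRho * F)"
  using bidegree_le_bX[OF bidegree_le_bX, of N F] bidegree_le_bY[OF bidegree_le_bY, of N F]
  by (simp add: bRho_def distrib_right mult.assoc bidegree_le_add)

lemma bipoly_induct [case_names monom add]:
  assumes m: "\<And>a i j. P (monom (monom a i) j)" and add: "\<And>F G. P F \<Longrightarrow> P G \<Longrightarrow> P (F + G)"
  shows "P (F :: real poly poly)"
proof -
  have 0: "P 0" using m[of 0 0 0] by simp
  have sum: "P (\<Sum>k\<in>K. H k)" if "\<And>k. P (H k)" for H :: "nat \<Rightarrow> real poly poly" and K
    by (induction K rule: infinite_finite_induct) (auto simp: 0 add that)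
  have "P (monom f j)" for f j
  proof -
    have "P (\<Sum>i\<le>degree f. monom (monom (coeff f i) i) j)"
      by (rule sum) (rule m)
    also have "(\<Sum>i\<le>degree f. monom (monom (coeff f i) i) j) = monom f j"
      by (subst (3) poly_as_sum_of_monoms [symmetric]) (simp only: monom_sum)
    finally show ?thesis .
  qed
  then have "P (\<Sum>j\<le>degree F. monom (coeff F j) j)"
    by (rule sum)
  then show ?thesis by (simp only: poly_as_sum_of_monoms)
qed

text \<open>If F is a polynomial in t and s, then its integral along a chord of the disk at distance t from
  the center is (1 - t^2)^mu times this polynomial in t. Moments of odd order vanish, so only exact
  divisions by 2 contribute.\<close>
definition slice_int :: "real \<Rightarrow> real poly poly \<Rightarrow> real poly" where
  "slice_int \<mu> F = (\<Sum>j\<le>degree F. smult (moment (\<mu> - 1/2) j) (coeff F j * [:1, 0, -1:] ^ (j div 2)))"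

lemma slice_int_eq:
  assumes "degree F \<le> N"
  shows "slice_int \<mu> F = (\<Sum>j\<le>N. smult (moment (\<mu> - 1/2) j) (coeff F j * [:1, 0, -1:] ^ (j div 2)))"
  unfolding slice_int_def using assms
  by (intro sum.mono_neutral_left) (auto simp: coeff_eq_0)

lemma slice_int_add: "slice_int \<mu> (F + G) = slice_int \<mu> F + slice_int \<mu> G"
proof -
  define N where "N = max (degree F) (degree G)"
  have "degree F \<le> N" "degree G \<le> N" "degree (F + G) \<le> N"
    using degree_add_le_max[of F G] by (auto simp: N_def)
  then show ?thesis
    by (simp only: slice_int_eq coeff_add distrib_right smult_add_right sum.distrib)
qed

lemma slice_int_smult: "slice_int \<mu> (smult f F) = f * slice_int \<mu> F"
proof -
  have "slice_int \<mu> (smult f F) =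
      (\<Sum>j\<le>degree F. smult (moment (\<mu> - 1/2) j) (f * coeff F j * [:1, 0, -1:] ^ (j div 2)))"
    by (subst slice_int_eq[of _ "degree F"]) (auto simp: degree_smult_le)
  then show ?thesis
    by (simp only: slice_int_def sum_distrib_left mult_smult_right mult.assoc)
qed

lemma slice_int_monom:
  "slice_int \<mu> (monom f j) = smult (moment (\<mu> - 1/2) j) (f * [:1, 0, -1:] ^ (j div 2))"
proof -
  have "slice_int \<mu> (monom f j) = (\<Sum>k\<in>{j}. smult (moment (\<mu> - 1/2) k) (coeff (monom f j) k * [:1, 0, -1:] ^ (k div 2)))"
    unfolding slice_int_eq[OF degree_monom_le] by (rule sum.mono_neutral_right) auto
  then show ?thesis by simp
qed

lemma degree_weight_power: "degree ([:1, 0, -1 :: real:] ^ m) \<le> 2 * m"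
  by (rule order.trans[OF degree_power_le]) auto

text \<open>Integration over the chord replaces s^j by a power of 1 - t^2 of degree at most j in t,
  so the total degree bounds the degree in t.\<close>

lemma degree_slice_int:
  assumes "bidegree_le N F"
  shows "degree (slice_int \<mu> F) \<le> N"
  unfolding slice_int_def
proof (intro degree_sum_le)
  fix j
  show "degree (smult (moment (\<mu> - 1/2) j) (coeff F j * [:1, 0, -1:] ^ (j div 2))) \<le> N"
  proof (cases "coeff F j = 0")
    case False
    then have "degree (coeff F j) + j \<le> N"
      using assms unfolding bidegree_le_def by (metis leading_coeff_0_iff)
    moreover have "degree (smult (moment (\<mu> - 1/2) j) (coeff F j * [:1, 0, -1:] ^ (j div 2))) \<le>
        degree (coeff F j) + 2 * (j div 2)"
      by (intro order.trans[OF degree_smult_le] order.trans[OF degree_mult_le] add_mono degree_weight_power) auto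
    ultimately show ?thesis by linarith
  qed auto
qed auto

text \<open>At t = 1 the chord shrinks to the point (1, 0). For j >= 2 the power of 1 - t^2 vanishes
  there; for j = 1, where \<open>j div 2\<close> is 0, the odd moment does.\<close>

lemma poly_slice_int_1: "\<mu> > -1/2 \<Longrightarrow> poly (slice_int \<mu> F) 1 = moment (\<mu> - 1/2) 0 * bieval 1 0 F"
proof (induction F rule: bipoly_induct)
  case (monom a i j)
  then have "moment (\<mu> - 1/2) j * (0 :: real) ^ (j div 2) = moment (\<mu> - 1/2) 0 * 0 ^ j"
    by (cases "even j") (auto simp: power_0_left moment_odd elim!: evenE)
  then show ?case
    by (simp add: slice_int_monom bieval_def poly_monom mult_ac)
qed (simp add: slice_int_add algebra_simps)

text \<open>The integral of F over the disk, so that rotation invariance has to be proved: it is derived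
  from the moments, through the generator of the rotations below.\<close>
definition disk_int :: "real \<Rightarrow> real poly poly \<Rightarrow> real" where
  "disk_int \<mu> F = jacobi_int \<mu> \<mu> (slice_int \<mu> F)"

lemma disk_int_add: "\<mu> > -1/2 \<Longrightarrow> disk_int \<mu> (F + G) = disk_int \<mu> F + disk_int \<mu> G"
  by (simp add: disk_int_def slice_int_add jacobi_int_add)

lemma disk_int_scale: "disk_int \<mu> (smult [:c:] F) = c * disk_int \<mu> F"
  by (simp add: disk_int_def slice_int_smult jacobi_int_smult)

lemma disk_int_0 [simp]: "disk_int \<mu> 0 = 0"
  using disk_int_scale[of \<mu> 0 0] by simp

lemma disk_int_diff: "\<mu> > -1/2 \<Longrightarrow> disk_int \<mu> (F - G) = disk_int \<mu> F - disk_int \<mu> G"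
  using disk_int_add[of \<mu> "F - G" G] by simp

abbreviation bimonom :: "nat \<Rightarrow> nat \<Rightarrow> real poly poly" where
  "bimonom i j \<equiv> monom (monom 1 i) j"

lemma disk_int_bimonom:
  "disk_int \<mu> (bimonom i j) = moment (\<mu> - 1/2) j * moment (\<mu> + real (j div 2)) i"
  by (simp add: disk_int_def slice_int_monom jacobi_int_smult moment_def jacobi_int_raise_power)

text \<open>Both recurrences carry the same factor i + j + 2 mu + 3, which depends only on the total
  degree. This symmetry between t and s is the source of rotation invariance. For odd j all terms
  vanish; for even j the recurrences come from the one-dimensional ones with exponents mu - 1/2 and
  mu + j / 2.\<close>

lemma disk_int_bimonom_step:
  assumes mu: "\<mu> > -1/2"
  shows "(real i + real j + 2 * \<mu> + 3) * disk_int \<mu> (bimonom (i + 2) j) = (real i + 1) * disk_int \<mu> (bimonom i j)"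
    and "(real i + real j + 2 * \<mu> + 3) * disk_int \<mu> (bimonom i (j + 2)) = (real j + 1) * disk_int \<mu> (bimonom i j)"
proof -
  have "(real i + real j + 2 * \<mu> + 3) * disk_int \<mu> (bimonom (i + 2) j) = (real i + 1) * disk_int \<mu> (bimonom i j) \<and>
    (real i + real j + 2 * \<mu> + 3) * disk_int \<mu> (bimonom i (j + 2)) = (real j + 1) * disk_int \<mu> (bimonom i j)"
  proof (cases "even j")
    case False
    then show ?thesis using mu by (simp add: disk_int_bimonom moment_odd)
  next
    case True
    define \<nu> where "\<nu> = \<mu> + real (j div 2)"
    define d where "d = real i + real j + 2 * \<mu> + 3"
    have nu: "\<nu> > -1" "2 * \<nu> = 2 * \<mu> + real j" using mu True by (auto simp: \<nu>_def elim!: evenE)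
    have s1: "d * moment \<nu> (i + 2) = (real i + 1) * moment \<nu> i"
      using moment_step[OF nu(1), of i] nu(2) by (simp add: d_def add_ac)
    have s2: "d * moment (\<nu> + 1) i = (real j + 2 * \<mu> + 2) * moment \<nu> i"
      using s1 unfolding moment_raise[OF nu(1)] by (simp add: d_def algebra_simps)
    have s3: "(real j + 2 * \<mu> + 2) * moment (\<mu> - 1/2) (j + 2) = (real j + 1) * moment (\<mu> - 1/2) j"
      using moment_step[of "\<mu> - 1/2" j] mu by (simp add: algebra_simps)
    have "d * (moment (\<mu> - 1/2) (j + 2) * moment (\<nu> + 1) i) =
        moment (\<mu> - 1/2) (j + 2) * ((real j + 2 * \<mu> + 2) * moment \<nu> i)"
      by (simp add: s2 [symmetric])
    also have "\<dots> = ((real j + 2 * \<mu> + 2) * moment (\<mu> - 1/2) (j + 2)) * moment \<nu> i"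
      by (simp only: mult_ac)
    also have "\<dots> = (real j + 1) * (moment (\<mu> - 1/2) j * moment \<nu> i)"
      unfolding s3 by (simp only: mult_ac)
    finally have "d * (moment (\<mu> - 1/2) (j + 2) * moment (\<nu> + 1) i) =
        (real j + 1) * (moment (\<mu> - 1/2) j * moment \<nu> i)" .
    moreover have "d * (moment (\<mu> - 1/2) j * moment \<nu> (i + 2)) = (real i + 1) * (moment (\<mu> - 1/2) j * moment \<nu> i)"
      using s1 by (simp add: mult.left_commute)
    ultimately show ?thesis
      by (simp add: disk_int_bimonom d_def \<nu>_def add_ac)
  qed
  then show "(real i + real j + 2 * \<mu> + 3) * disk_int \<mu> (bimonom (i + 2) j) = (real i + 1) * disk_int \<mu> (bimonom i j)"
    and "(real i + real j + 2 * \<mu> + 3) * disk_int \<mu> (bimonom i (j + 2)) = (real j + 1) * disk_int \<mu> (bimonom i j)"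
    by auto
qed

lemma bX_times_monom: "bX * monom (monom a i) j = monom (monom a (Suc i)) j"
  by (simp add: smult_monom monom_Suc)

lemma bY_times_monom: "bY * monom f j = monom f (Suc j)"
  by (simp add: monom_Suc)

text \<open>Adding the two recurrences shows that one factor t^2 + s^2 multiplies the integral by (i
  + j + 2) / (i + j + 2 mu + 3), which depends on the total degree alone and so can be
  iterated.\<close>

lemma disk_int_bRho_power_bimonom:
  assumes mu: "\<mu> > -1/2"
  shows "disk_int \<mu> (bRho ^ N * bimonom i j) =
    pochhammer ((real i + real j) / 2 + 1) N / pochhammer ((real i + real j) / 2 + \<mu> + 3/2) N *
    disk_int \<mu> (bimonom i j)"
proof (induction N arbitrary: i j)
  case (Suc N)
  let ?d = "(real i + real j) / 2"
  have pos: "?d + \<mu> + 3/2 > 0" proof -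
    have "?d \<ge> 0" by simp
    with mu show ?thesis by linarith
  qed
  have "bRho * bimonom i j = bimonom (i + 2) j + bimonom i (j + 2)"
    by (simp only: bRho_def distrib_right mult.assoc bX_times_monom bY_times_monom) simp
  then have "bRho ^ Suc N * bimonom i j = bRho ^ N * bimonom (i + 2) j + bRho ^ N * bimonom i (j + 2)"
    by (metis power_Suc2 mult.assoc distrib_left)
  then have "disk_int \<mu> (bRho ^ Suc N * bimonom i j) =
      disk_int \<mu> (bRho ^ N * bimonom (i + 2) j) + disk_int \<mu> (bRho ^ N * bimonom i (j + 2))"
    by (simp only: disk_int_add[OF mu])
  also have "\<dots> = pochhammer (?d + 2) N / pochhammer (?d + \<mu> + 5/2) N *
      (disk_int \<mu> (bimonom (i + 2) j) + disk_int \<mu> (bimonom i (j + 2)))"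
  proof -
    have "(real (i + 2) + real j) / 2 + 1 = ?d + 2" "(real i + real (j + 2)) / 2 + 1 = ?d + 2"
      "(real (i + 2) + real j) / 2 + \<mu> + 3/2 = ?d + \<mu> + 5/2"
      "(real i + real (j + 2)) / 2 + \<mu> + 3/2 = ?d + \<mu> + 5/2"
      by (simp_all add: field_simps)
    then show ?thesis unfolding Suc.IH by (simp only: distrib_left)
  qed
  also have "disk_int \<mu> (bimonom (i + 2) j) + disk_int \<mu> (bimonom i (j + 2)) =
      (?d + 1) / (?d + \<mu> + 3/2) * disk_int \<mu> (bimonom i j)"
  proof -
    have "(2 * (?d + \<mu> + 3/2)) * (disk_int \<mu> (bimonom (i + 2) j) + disk_int \<mu> (bimonom i (j + 2))) =
        (2 * (?d + 1)) * disk_int \<mu> (bimonom i j)"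
    proof -
      have e: "2 * (?d + \<mu> + 3/2) = real i + real j + 2 * \<mu> + 3" "2 * (?d + 1) = (real i + 1) + (real j + 1)"
        by (simp_all add: field_simps)
      show ?thesis
        unfolding e distrib_left[of "real i + real j + 2 * \<mu> + 3"] disk_int_bimonom_step[OF mu]
        by (simp only: distrib_right)
    qed
    moreover have "y = z / x * w" if "(2 * x) * y = (2 * z) * w" "x > 0" for x y z w :: real
      using that by (simp add: eq_divide_eq mult_ac)
    ultimately show ?thesis using pos by blast
  qed
  also have "pochhammer (?d + 2) N / pochhammer (?d + \<mu> + 5/2) N *
      ((?d + 1) / (?d + \<mu> + 3/2) * disk_int \<mu> (bimonom i j)) =
      pochhammer (?d + 1) (Suc N) / pochhammer (?d + \<mu> + 3/2) (Suc N) * disk_int \<mu> (bimonom i j)"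
    by (simp add: pochhammer_rec add_ac mult_ac)
  finally show ?case .
qed simp

section \<open>Orthogonality of the projected polynomials\<close>

text \<open>The infinitesimal rotation t d/ds - s d/dt.\<close>
definition birot :: "real poly poly \<Rightarrow> real poly poly" where
  "birot F = bX * pderiv F - bY * map_poly pderiv F"

lemma map_poly_pderiv_add: "map_poly pderiv (F + G) = map_poly pderiv F + map_poly pderiv (G :: real poly poly)"
  by (rule poly_eqI) (simp add: coeff_map_poly pderiv_add)

lemma birot_add: "birot (F + G) = birot F + birot G"
  by (simp add: birot_def pderiv_add map_poly_pderiv_add smult_add_right algebra_simps)

lemma birot_bX: "birot (bX * F) = bX * birot F - bY * F"
proof -
  have "map_poly pderiv (bX * F) = F + bX * map_poly pderiv F"
    by (rule poly_eqI) (simp add: coeff_map_poly pderiv_pCons)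
  moreover have "pderiv (bX * F) = bX * pderiv F" by (simp add: pderiv_smult)
  ultimately show ?thesis unfolding birot_def by (simp only: right_diff_distrib distrib_left mult_ac diff_diff_add add_ac)
qed

lemma birot_bY: "birot (bY * F) = bY * birot F + bX * F"
proof -
  have "map_poly pderiv (bY * F) = bY * map_poly pderiv F"
    by (simp add: map_poly_pCons)
  moreover have "pderiv (bY * F) = F + bY * pderiv F" by (simp add: pderiv_pCons)
  ultimately show ?thesis unfolding birot_def by (simp only: algebra_simps)
qed

lemma birot_bRho: "birot (bRho * F) = bRho * birot F"
  unfolding bRho_def distrib_right mult.assoc birot_add birot_bX birot_bY
  by (simp only: algebra_simps)

text \<open>On t^i s^j the generator yields j t^(i+1) s^(j-1) - i t^(i-1) s^(j+1). By the two
  recurrences both terms have the integral of t^(i-1) s^(j-1) times i j over the common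
  factor.\<close>

lemma disk_int_birot:
  assumes mu: "\<mu> > -1/2"
  shows "disk_int \<mu> (birot F) = 0"
proof (induction F rule: bipoly_induct)
  case (monom a i j)
  have a: "monom (monom a i) j = smult [:a:] (bimonom i j)" for i j
    by (simp add: smult_monom)
  have "birot (monom (monom a i) j) =
      bX * monom (monom (real j * a) i) (j - 1) - bY * monom (monom (real i * a) (i - 1)) j"
    by (simp add: birot_def pderiv_monom map_poly_monom of_nat_poly smult_monom)
  also have "\<dots> = smult [:real j * a:] (bimonom (Suc i) (j - 1)) - smult [:real i * a:] (bimonom (i - 1) (Suc j))"
    by (simp only: bX_times_monom bY_times_monom) (simp add: smult_monom)
  finally have "disk_int \<mu> (birot (monom (monom a i) j)) =
      a * (real j * disk_int \<mu> (bimonom (Suc i) (j - 1)) - real i * disk_int \<mu> (bimonom (i - 1) (Suc j)))"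
    by (simp only: disk_int_diff[OF mu] disk_int_scale) (simp add: algebra_simps)
  also have "real j * disk_int \<mu> (bimonom (Suc i) (j - 1)) = real i * disk_int \<mu> (bimonom (i - 1) (Suc j))"
  proof (cases "i = 0 \<or> j = 0")
    case True
    \<comment> \<open>On each side either the coefficient is 0 or one variable has exponent 1, whose
      moment vanishes.\<close>
    then show ?thesis using mu by (auto simp: disk_int_bimonom moment_odd)
  next
    case False
    then obtain i' j' where ij: "i = Suc i'" "j = Suc j'" by (metis not0_implies_Suc)
    define c where "c = real i' + real j' + 2 * \<mu> + 3"
    have "c * disk_int \<mu> (bimonom (Suc i) (j - 1)) = real i * disk_int \<mu> (bimonom i' j')"
      "c * disk_int \<mu> (bimonom (i - 1) (Suc j)) = real j * disk_int \<mu> (bimonom i' j')"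
      using disk_int_bimonom_step[OF mu, of i' j'] unfolding ij c_def by (simp_all add: add_ac)
    then have "c * (real j * disk_int \<mu> (bimonom (Suc i) (j - 1))) =
        c * (real i * disk_int \<mu> (bimonom (i - 1) (Suc j)))"
      by (metis mult.left_commute)
    moreover have "c > 0" using mu unfolding c_def by linarith
    ultimately show ?thesis by simp
  qed
  finally show ?case by simp
qed (simp add: birot_add disk_int_add[OF mu])

text \<open>Real and imaginary part of (t + i s)^j.\<close>
fun bicos bisin :: "nat \<Rightarrow> real poly poly" where
  "bicos 0 = 1"
| "bisin 0 = 0"
| "bicos (Suc j) = bX * bicos j - bY * bisin j"
| "bisin (Suc j) = bX * bisin j + bY * bicos j"

lemmas bicos_Suc = bicos.simps(2)
lemmas bisin_Suc = bisin.simps(2)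
declare bicos.simps(2) [simp del] bisin.simps(2) [simp del]

lemma bieval_bicos_bisin:
  "bieval t s (bicos j) = Re (Complex t s ^ j) \<and> bieval t s (bisin j) = Im (Complex t s ^ j)"
  by (induction j) (simp_all add: bicos_Suc bisin_Suc algebra_simps)

lemma bieval_bRho [simp]: "bieval t s bRho = t\<^sup>2 + s\<^sup>2"
  by (simp add: bRho_def power2_eq_square)

lemma bidegree_le_bicos_bisin: "bidegree_le j (bicos j) \<and> bidegree_le j (bisin j)"
proof (induction j)
  case 0
  show ?case by (auto simp: bidegree_le_def coeff_1 split: if_splits)
next
  case (Suc j)
  then show ?case unfolding bicos_Suc bisin_Suc
    by (intro conjI bidegree_le_add bidegree_le_diff bidegree_le_bX bidegree_le_bY) auto
qed

text \<open>The generator maps z = t + i s to i z; being a derivation, it maps z^j to i j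
  z^j.\<close>

lemma birot_bicos_bisin:
  "birot (bicos j) = smult [:- real j:] (bisin j) \<and> birot (bisin j) = smult [:real j:] (bicos j)"
proof (induction j)
  case 0
  have "map_poly pderiv (1 :: real poly poly) = 0"
    by (simp add: one_pCons map_poly_pCons)
  then show ?case by (simp add: birot_def)
next
  case (Suc j)
  have "birot (bicos (Suc j)) = bX * birot (bicos j) - bY * bicos j - (bY * birot (bisin j) + bX * bisin j)"
    using birot_add[of "bicos (Suc j)" "bY * bisin j"]
    by (simp only: bicos_Suc diff_add_cancel birot_bX birot_bY eq_diff_eq)
  moreover have "birot (bisin (Suc j)) = bX * birot (bisin j) - bY * bisin j + (bY * birot (bicos j) + bX * bicos j)"
    by (simp only: bisin_Suc birot_add birot_bX birot_bY)
  moreover have "birot (bicos j) = - [:[:real j:]:] * bisin j" "birot (bisin j) = [:[:real j:]:] * bicos j"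
    using Suc by simp_all
  \<comment> \<open>Pure ring identities in which \<open>R\<close> stands for the constant j;
    keeping it a variable prevents it from being turned into a scalar multiplication.\<close>
  moreover have "X * (- R * s) - Y * c - (Y * (R * c) + X * s) = (- (R + 1)) * (X * s + Y * c)"
    "X * (R * c) - Y * s + (Y * (- R * s) + X * c) = (R + 1) * (X * c - Y * s)" for X Y R s c :: "real poly poly"
    by (simp_all add: algebra_simps)
  moreover have "[:[:- real (Suc j):]:] = - ([:[:real j:]:] + 1)" "[:[:real (Suc j):]:] = [:[:real j:]:] + 1"
    by (simp_all add: one_pCons)
  then have "smult [:- real (Suc j):] F = (- ([:[:real j:]:] + 1)) * F"
    "smult [:real (Suc j):] F = ([:[:real j:]:] + 1) * F" for F
    by (metis mult_pCons_left mult_zero_left pCons_0_0 add_0_right)+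
  ultimately show ?case by (simp only: bicos_Suc bisin_Suc)
qed

text \<open>The generator annihilates t^2 + s^2, so this polynomial is 1 / j times the image of its
  sine counterpart, and such images have integral 0.\<close>

lemma disk_int_bRho_bicos:
  assumes "\<mu> > -1/2" "j > 0"
  shows "disk_int \<mu> (bRho ^ N * bicos j) = 0"
proof -
  have "birot (bRho ^ N * bisin j) = bRho ^ N * birot (bisin j)"
    by (induction N) (simp_all add: mult.assoc birot_bRho)
  also have "\<dots> = smult [:real j:] (bRho ^ N * bicos j)"
    using birot_bicos_bisin[of j] by simp
  finally show ?thesis
    using disk_int_birot[OF assms(1), of "bRho ^ N * bisin j"] assms(2) by (simp add: disk_int_scale)
qed

section \<open>Radial polynomials and the reduction to one variable\<close>

definition radial :: "real poly \<Rightarrow> real poly poly" where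
  "radial g = poly (map_poly (\<lambda>c. [:[:c:]:]) g) bRho"

lemma radial_pCons: "radial (pCons a g) = [:[:a:]:] + bRho * radial g"
  by (simp add: radial_def map_poly_pCons)

lemma radial_0 [simp]: "radial 0 = 0"
  by (simp add: radial_def)

lemma bieval_radial [simp]: "bieval t s (radial g) = poly g (t\<^sup>2 + s\<^sup>2)"
  by (induction g) (simp_all add: radial_pCons)

lemma bidegree_le_radial:
  "bidegree_le j F \<Longrightarrow> degree g \<le> l \<Longrightarrow> bidegree_le (j + 2 * l) (radial g * F)"
proof (induction l arbitrary: g)
  case 0
  then obtain a where "g = [:a:]" by (metis degree_0_id le_zero_eq degree_eq_zeroE)
  with 0 show ?case by (auto simp: radial_pCons bidegree_le_def)
next
  case (Suc l)
  obtain a h where g: "g = pCons a h" by (cases g)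
  have "degree h \<le> l" using Suc.prems(2) by (cases "h = 0") (auto simp: g)
  then have "bidegree_le (j + 2 * l + 2) (bRho * (radial h * F))"
    by (intro bidegree_le_bRho Suc)
  moreover have "bidegree_le (j + 2 * l + 2) (smult [:a:] F)"
    by (rule bidegree_le_mono[of j]) (use Suc.prems(1) in \<open>auto simp: bidegree_le_def\<close>)
  ultimately show ?case
    by (simp add: g radial_pCons distrib_right mult.assoc bidegree_le_add)
qed

lemma disk_int_bRho_radial_bicos:
  assumes "\<mu> > -1/2" "j > 0"
  shows "disk_int \<mu> (bRho ^ N * (radial g * bicos j)) = 0"
proof (induction g arbitrary: N)
  case (pCons a g)
  have "bRho ^ N * (radial (pCons a g) * bicos j) =
      smult [:a:] (bRho ^ N * bicos j) + bRho ^ Suc N * (radial g * bicos j)"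
    by (simp add: radial_pCons algebra_simps)
  then show ?case
    using pCons.IH[of "Suc N"] by (simp only: disk_int_add[OF assms(1)] disk_int_scale disk_int_bRho_bicos[OF assms])
qed simp

text \<open>In polar coordinates both sides would be multiples of the integral of rho^N g(rho) (1 -
  rho)^(mu - 1/2) over [0, 1], with rho = (1 + t) / 2. Instead they are compared on powers of rho,
  where both yield (1)_N / (mu + 3/2)_N. The factor on the left is the mass of the one-dimensional
  weight. Carrying rho^N along lets the induction move factors out of g.\<close>

lemma disk_int_bRho_radial:
  assumes mu: "\<mu> > -1/2"
  shows "Beta (\<mu> + 1/2) 1 * 2 powr (\<mu> + 1/2) * disk_int \<mu> (bRho ^ N * radial g) =
    disk_int \<mu> 1 * jacobi_int (\<mu> - 1/2) 0 ([:1/2, 1/2:] ^ N * pcompose g [:1/2, 1/2:])"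
proof (induction g arbitrary: N)
  case (pCons a g)
  have ab: "\<mu> - 1/2 > -1" "(0::real) > -1" using mu by auto
  have "jacobi_int (\<mu> - 1/2) 0 ([:1/2, 1/2:] ^ N) = 2 powr (\<mu> + 1/2) * Beta (\<mu> + 1/2) (1 + real N)"
    using jacobi_int_Beta[OF ab, of 0 N] by (simp add: add.commute)
  also have "Beta (\<mu> + 1/2) (1 + real N) = pochhammer 1 N / pochhammer (\<mu> + 3/2) N * Beta (\<mu> + 1/2) 1"
    using Beta_add_nat_left[of 1 "\<mu> + 1/2" N] mu by (simp add: Beta_commute add_ac)
  finally have 1: "jacobi_int (\<mu> - 1/2) 0 ([:1/2, 1/2:] ^ N) =
      2 powr (\<mu> + 1/2) * Beta (\<mu> + 1/2) 1 * (pochhammer 1 N / pochhammer (\<mu> + 3/2) N)" by simp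
  have 2: "disk_int \<mu> (bRho ^ N) = pochhammer 1 N / pochhammer (\<mu> + 3/2) N * disk_int \<mu> 1"
    using disk_int_bRho_power_bimonom[OF mu, of N 0 0] by (simp add: monom_0 flip: one_pCons)
  have "bRho ^ N * radial (pCons a g) = smult [:a:] (bRho ^ N) + bRho ^ Suc N * radial g"
    by (simp add: radial_pCons algebra_simps)
  then have "disk_int \<mu> (bRho ^ N * radial (pCons a g)) =
      a * disk_int \<mu> (bRho ^ N) + disk_int \<mu> (bRho ^ Suc N * radial g)"
    by (simp only: disk_int_add[OF mu] disk_int_scale)
  moreover have "[:1/2, 1/2:] ^ N * pcompose (pCons a g) [:1/2, 1/2:] =
      smult a ([:1/2, 1/2:] ^ N) + [:1/2, 1/2:] ^ Suc N * pcompose g [:1/2, 1/2:]"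
    by (simp only: pcompose_pCons distrib_left power_Suc2 mult.assoc) simp
  then have "jacobi_int (\<mu> - 1/2) 0 ([:1/2, 1/2:] ^ N * pcompose (pCons a g) [:1/2, 1/2:]) =
      a * jacobi_int (\<mu> - 1/2) 0 ([:1/2, 1/2:] ^ N) +
      jacobi_int (\<mu> - 1/2) 0 ([:1/2, 1/2:] ^ Suc N * pcompose g [:1/2, 1/2:])"
    by (simp only: jacobi_int_add[OF ab] jacobi_int_smult)
  ultimately show ?case
    using pCons.IH[of "Suc N"] by (simp only: 1 2 distrib_left) (simp only: mult_ac)
qed (simp add: jacobi_int_smult[of _ _ 0 0, simplified])

text \<open>This is the real part of (z + cnj z) z^(j+1), with z times its conjugate equal to
  rho.\<close>

lemma double_bX_bicos: "bX * bicos (Suc j) + bX * bicos (Suc j) = bicos (Suc (Suc j)) + bRho * bicos j"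
proof -
  have "bicos (Suc (Suc j)) + bRho * bicos j =
      bX * bicos (Suc j) - bY * (bX * bisin j + bY * bicos j) + (bX * bX + bY * bY) * bicos j"
    by (simp only: bicos_Suc[of "Suc j"] bisin_Suc bRho_def)
  also have "\<dots> = bX * bicos (Suc j) + bX * (bX * bicos j - bY * bisin j)"
    by (simp only: algebra_simps)
  finally show ?thesis by (simp only: bicos_Suc)
qed

text \<open>Multiplying by t = (z + cnj z) / 2 moves the angular frequency by one in either direction.
  Frequency 0, the only one with a nonzero integral, is reached from j after j + i steps down
  and i steps up.\<close>
lemma disk_int_bX_power_bicos:
  assumes mu: "\<mu> > -1/2"
    and "\<And>i. j + 2 * i \<le> m \<Longrightarrow> disk_int \<mu> (bRho ^ (j + i) * radial g) = 0"
  shows "disk_int \<mu> (bX ^ m * (radial g * bicos j)) = 0"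
  using assms(2)
proof (induction m arbitrary: j g)
  case 0
  then show ?case
    using disk_int_bRho_radial_bicos[OF mu, of j 0 g] 0[of 0] by (cases "j = 0") auto
next
  case (Suc m)
  show ?case
  proof (cases j)
    case 0
    have "disk_int \<mu> (bX ^ m * (radial g * bicos 1)) = 0"
    proof (rule Suc.IH)
      fix i assume "1 + 2 * i \<le> m"
      then show "disk_int \<mu> (bRho ^ (1 + i) * radial g) = 0"
        using Suc.prems[of "Suc i"] 0 by simp
    qed
    moreover have "bicos 1 = bX" using bicos_Suc[of 0] by simp
    ultimately show ?thesis by (simp only: 0 bicos.simps(1) power_Suc mult_1_left mult_1_right mult_ac)
  next
    case (Suc j')
    \<comment> \<open>A step up lengthens the way back to frequency 0 by one further step up, hence
      the index \<open>Suc i\<close> in the assumption.\<close>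
    have 1: "disk_int \<mu> (bX ^ m * (radial g * bicos (Suc (Suc j')))) = 0"
    proof (rule Suc.IH)
      fix i assume "Suc (Suc j') + 2 * i \<le> m"
      then show "disk_int \<mu> (bRho ^ (Suc (Suc j') + i) * radial g) = 0"
        using Suc.prems[of "Suc i"] Suc by simp
    qed
    \<comment> \<open>A step down releases a factor rho, which is stored in the radial part:
      \<open>pCons 0 g\<close> is the polynomial g multiplied by its variable.\<close>
    have 2: "disk_int \<mu> (bX ^ m * (radial (pCons 0 g) * bicos j')) = 0"
    proof (rule Suc.IH)
      fix i assume "j' + 2 * i \<le> m"
      then show "disk_int \<mu> (bRho ^ (j' + i) * radial (pCons 0 g)) = 0"
        using Suc.prems[of i] Suc by (simp add: radial_pCons mult_ac)
    qed
    have "bX ^ m * (radial g * bicos (Suc (Suc j'))) + bX ^ m * (radial (pCons 0 g) * bicos j') =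
        bX ^ m * (radial g * (bicos (Suc (Suc j')) + bRho * bicos j'))"
      by (simp add: radial_pCons algebra_simps)
    also have "\<dots> = bX ^ Suc m * (radial g * bicos j) + bX ^ Suc m * (radial g * bicos j)"
      unfolding double_bX_bicos [symmetric] Suc by (simp only: algebra_simps power_Suc)
    finally have "disk_int \<mu> (bX ^ Suc m * (radial g * bicos j)) + disk_int \<mu> (bX ^ Suc m * (radial g * bicos j)) = 0"
      using 1 2 by (metis add.right_neutral disk_int_add[OF mu])
    then show ?thesis by simp
  qed
qed

text \<open>Testing against t^m gives the disk integral of t^m g(rho) Re z^j, which involves only
  integrals of rho^(j+i) g(rho) with j + 2i <= m, so i < l. With rho = (1 + t) / 2 the factor rho^j
  raises the exponents of the weight from (mu - 1/2, 0) to (mu - 1/2, j), for which the Jacobi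
  polynomial in g is orthogonal to the remaining power of degree i.\<close>

lemma jacobi_int_slice_orthogonal:
  assumes mu: "\<mu> > -1/2" and q: "degree q < j + 2 * l"
  defines "g \<equiv> pcompose (jacobi_hyp (\<mu> - 1/2) (real j) l) [:-1, 2:]"
  shows "jacobi_int \<mu> \<mu> (slice_int \<mu> (radial g * bicos j) * q) = 0"
proof -
  let ?\<alpha> = "\<mu> - 1/2" and ?h = "jacobi_hyp (\<mu> - 1/2) (real j) l"
  have mu': "\<mu> > -1" using mu by simp
  have g: "pcompose g [:1/2, 1/2:] = ?h"
    unfolding g_def by (simp add: pcompose_assoc [symmetric] pcompose_pCons pcompose_idR)
  have "Beta (\<mu> + 1/2) 1 * 2 powr (\<mu> + 1/2) > 0"
    using mu by (simp add: Beta_def Gamma_real_pos)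
  then have C: "Beta (\<mu> + 1/2) 1 \<noteq> 0" by auto
  have power: "jacobi_int \<mu> \<mu> (slice_int \<mu> (radial g * bicos j) * monom 1 m) = 0" if m: "m < j + 2 * l" for m
  proof -
    have "disk_int \<mu> (bX ^ m * (radial g * bicos j)) = 0"
    proof (rule disk_int_bX_power_bicos[OF mu])
      fix i assume "j + 2 * i \<le> m"
      then have i: "i < l" using m by linarith
      have "jacobi_int ?\<alpha> 0 ([:1/2, 1/2:] ^ (j + i) * ?h) =
          1 / 2 ^ j * jacobi_int ?\<alpha> (real j) (?h * [:1/2, 1/2:] ^ i)"
      proof (rule jacobi_int_eqI)
        fix t :: real assume t: "-1 < t" "t < 1"
        have "poly ([:1/2, 1/2:] ^ j) t = ((1 + t) / 2) ^ j"
          by (simp add: add_divide_distrib)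
        then show "poly ([:1/2, 1/2:] ^ (j + i) * ?h) t * jacobi_weight ?\<alpha> 0 t =
            1 / 2 ^ j * (poly (?h * [:1/2, 1/2:] ^ i) t * jacobi_weight ?\<alpha> (real j) t)"
          using t by (simp add: power_add jacobi_weight_def powr_realpow power_divide)
      qed
      also have "\<dots> = 0"
        using jacobi_hyp_orthogonal[of ?\<alpha> "real j" "[:1/2, 1/2:] ^ i" l] mu i
          degree_linear_power_le[of "1/2" "1/2" i] by simp
      finally show "disk_int \<mu> (bRho ^ (j + i) * radial g) = 0"
        using disk_int_bRho_radial[OF mu, of "j + i" g] C g by simp
    qed
    moreover have "bX ^ m * F = smult (monom 1 m) F" for F
      by (simp add: poly_const_pow monom_altdef)
    ultimately show ?thesis
      by (simp add: disk_int_def slice_int_smult mult.commute)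
  qed
  have "q = (\<Sum>m\<le>degree q. smult (coeff q m) (monom 1 m))"
    by (simp add: smult_monom poly_as_sum_of_monoms)
  from arg_cong[OF this, of "\<lambda>p. jacobi_int \<mu> \<mu> (slice_int \<mu> (radial g * bicos j) * p)"]
  have "jacobi_int \<mu> \<mu> (slice_int \<mu> (radial g * bicos j) * q) =
      (\<Sum>m\<le>degree q. coeff q m * jacobi_int \<mu> \<mu> (slice_int \<mu> (radial g * bicos j) * monom 1 m))"
    by (simp only: sum_distrib_left mult_smult_right jacobi_int_sum[OF mu' mu'] jacobi_int_smult)
  also have "\<dots> = 0" using q by (intro sum.neutral) (simp add: power)
  finally show ?thesis .
qed

text \<open>With j + 2 * l in the role of k, the polynomial composed with 2 * rho - 1 is the radial factor
  of the disk basis.\<close>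
lemma slice_int_radial_bicos:
  assumes mu: "\<mu> > -1/2"
  shows "slice_int \<mu> (radial (pcompose (jacobi_hyp (\<mu> - 1/2) (real j) l) [:-1, 2:]) * bicos j) =
    smult (moment (\<mu> - 1/2) 0) (jacobi_hyp \<mu> \<mu> (j + 2 * l))"
proof -
  define g where "g = pcompose (jacobi_hyp (\<mu> - 1/2) (real j) l) [:-1, 2:]"
  have "degree g \<le> l"
    by (simp add: g_def degree_pcompose degree_jacobi_hyp_le)
  then have "degree (slice_int \<mu> (radial g * bicos j)) \<le> j + 2 * l"
    by (intro degree_slice_int bidegree_le_radial) (simp_all add: bidegree_le_bicos_bisin)
  then have "slice_int \<mu> (radial g * bicos j) =
      smult (poly (slice_int \<mu> (radial g * bicos j)) 1) (jacobi_hyp \<mu> \<mu> (j + 2 * l))"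
    using mu jacobi_int_slice_orthogonal[OF mu, of _ j l]
    by (intro jacobi_orthogonal_unique) (auto simp: g_def)
  \<comment> \<open>At (1, 0) one has rho = 1, so the Jacobi polynomial is taken at 2 - 1 = 1, and
    z^j = 1.\<close>
  also have "poly (slice_int \<mu> (radial g * bicos j)) 1 = moment (\<mu> - 1/2) 0"
  proof -
    have "bieval 1 0 (bicos j) = 1"
      using bieval_bicos_bisin[of 1 0 j] by (simp flip: one_complex.code complex_of_real_def)
    then show ?thesis using mu by (simp add: poly_slice_int_1 g_def poly_pcompose)
  qed
  finally show ?thesis by (simp add: g_def)
qed

section \<open>Radon projections of the disk basis\<close>

lemma rotation_norm:
  "(t * cos \<theta> - s * sin \<theta>)\<^sup>2 + (t * sin \<theta> + s * cos \<theta>)\<^sup>2 = t\<^sup>2 + (s :: real)\<^sup>2"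
proof -
  have "(t * c - s * d)\<^sup>2 + (t * d + s * c)\<^sup>2 = (t\<^sup>2 + s\<^sup>2) * (d\<^sup>2 + c\<^sup>2)" for c d :: real
    by algebra
  then show ?thesis by simp
qed

lemma set_integrable_one_minus_square_powr:
  fixes \<nu> :: real
  assumes "\<nu> > -1"
  shows "set_integrable lborel {-1..1} (\<lambda>u :: real. (1 - u\<^sup>2) powr \<nu>)"
  using set_integrable_jacobi_weight[OF assms assms]
  by (subst set_integrable_cong[OF refl]) (auto simp: one_minus_square_powr)

text \<open>With s = sqrt (1 - t^2) u the weight factors, since 1 - s^2 - t^2 = (1 - t^2) (1 - u^2).
  The exponent mu is mu - 1/2 from the weight plus 1/2 from ds.\<close>

lemma radon_rescale:
  assumes t: "-1 < t" "t < 1"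
  shows "radon \<mu> \<theta> f t = (1 - t\<^sup>2) powr \<mu> *
    (LBINT u:{-1..1}. f (t * cos \<theta> - sqrt (1 - t\<^sup>2) * u * sin \<theta>, t * sin \<theta> + sqrt (1 - t\<^sup>2) * u * cos \<theta>) *
      (1 - u\<^sup>2) powr (\<mu> - 1/2))"
proof -
  define \<sigma> where "\<sigma> = sqrt (1 - t\<^sup>2)"
  have pos: "1 - t\<^sup>2 > 0" using t by (simp add: abs_square_less_1 abs_less_iff)
  then have \<sigma>: "\<sigma> > 0" "\<sigma>\<^sup>2 = 1 - t\<^sup>2" by (simp_all add: \<sigma>_def)
  let ?F = "\<lambda>s. f (t * cos \<theta> - s * sin \<theta>, t * sin \<theta> + s * cos \<theta>)"
  let ?G = "\<lambda>s. indicator {-\<sigma>..\<sigma>} s *\<^sub>R (?F s * (1 - s\<^sup>2 - t\<^sup>2) powr (\<mu> - 1/2))"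
  have eq: "?G (0 + \<sigma> * u) = (1 - t\<^sup>2) powr (\<mu> - 1/2) *
      (indicator {-1..1} u *\<^sub>R (?F (\<sigma> * u) * (1 - u\<^sup>2) powr (\<mu> - 1/2)))" for u
  proof (cases "u \<in> {-1..1}")
    case True
    then have "\<sigma> * u \<in> {-\<sigma>..\<sigma>}"
      using \<sigma>(1) mult_left_mono[of "-1" u \<sigma>] mult_left_mono[of u 1 \<sigma>] by auto
    moreover have "(1 - (\<sigma> * u)\<^sup>2 - t\<^sup>2) = (1 - t\<^sup>2) * (1 - u\<^sup>2)"
      by (simp add: power_mult_distrib \<sigma>(2) algebra_simps)
    moreover have "1 - u\<^sup>2 \<ge> 0" using True by (simp add: abs_square_le_1 abs_le_iff)
    ultimately show ?thesis using True pos by (simp add: powr_mult)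
  next
    case False
    then have "\<sigma> * u \<notin> {-\<sigma>..\<sigma>}"
      using \<sigma>(1) mult_less_cancel_left_pos[of \<sigma> u "-1"] mult_less_cancel_left_pos[of \<sigma> 1 u] by auto
    with False show ?thesis by simp
  qed
  have "radon \<mu> \<theta> f t = (\<integral>s. ?G s \<partial>lborel)"
    by (simp add: radon_def set_lebesgue_integral_def \<sigma>_def)
  also have "\<dots> = \<sigma> * (\<integral>u. ?G (0 + \<sigma> * u) \<partial>lborel)"
    using lborel_integral_real_affine[of \<sigma> ?G 0] \<sigma>(1) by simp
  also have "\<dots> = (\<sigma> * (1 - t\<^sup>2) powr (\<mu> - 1/2)) *
      (LBINT u:{-1..1}. ?F (\<sigma> * u) * (1 - u\<^sup>2) powr (\<mu> - 1/2))"
    unfolding eq by (simp add: set_lebesgue_integral_def)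
  also have "\<sigma> * (1 - t\<^sup>2) powr (\<mu> - 1/2) = (1 - t\<^sup>2) powr \<mu>"
    using pos by (simp add: \<sigma>_def powr_half_sqrt [symmetric] powr_add [symmetric])
  finally show ?thesis by (simp add: \<sigma>_def)
qed

text \<open>Additivity needs integrability. The chord stays inside the disk, where f and g are
  continuous, so the integrands are continuous functions times an integrable weight.\<close>

lemma radon_linear:
  assumes mu: "\<mu> > -1/2" and t: "-1 < t" "t < 1"
    and f: "continuous_on unit_disk f" and g: "continuous_on unit_disk g"
  shows "radon \<mu> \<theta> (\<lambda>z. c * f z + d * g z) t = c * radon \<mu> \<theta> f t + d * radon \<mu> \<theta> g t"
proof -
  define \<gamma> where "\<gamma> = (\<lambda>u. (t * cos \<theta> - sqrt (1 - t\<^sup>2) * u * sin \<theta>, t * sin \<theta> + sqrt (1 - t\<^sup>2) * u * cos \<theta>))"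
  have pos: "1 - t\<^sup>2 > 0" using t by (simp add: abs_square_less_1 abs_less_iff)
  have \<gamma>: "\<gamma> ` {-1..1} \<subseteq> unit_disk"
  proof (rule image_subsetI)
    fix u :: real assume u: "u \<in> {-1..1}"
    have "(t * cos \<theta> - sqrt (1 - t\<^sup>2) * u * sin \<theta>)\<^sup>2 + (t * sin \<theta> + sqrt (1 - t\<^sup>2) * u * cos \<theta>)\<^sup>2 =
        t\<^sup>2 + (sqrt (1 - t\<^sup>2) * u)\<^sup>2"
      by (rule rotation_norm)
    also have "\<dots> = t\<^sup>2 + (1 - t\<^sup>2) * u\<^sup>2"
      using pos by (simp add: power_mult_distrib)
    also have "\<dots> \<le> t\<^sup>2 + (1 - t\<^sup>2) * 1"
    proof (intro add_left_mono mult_left_mono)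
      show "u\<^sup>2 \<le> 1" using u by (simp add: abs_square_le_1 abs_le_iff)
    qed (use pos in simp)
    finally show "\<gamma> u \<in> unit_disk" by (simp add: \<gamma>_def unit_disk_def)
  qed
  have int: "set_integrable lborel {-1..1} (\<lambda>u. h (\<gamma> u) * (1 - u\<^sup>2) powr (\<mu> - 1/2))"
    if "continuous_on unit_disk h" for h
    using \<gamma> mu by (intro set_integrable_continuous_times_weight set_integrable_one_minus_square_powr
        continuous_on_compose2[OF that]) (auto simp: \<gamma>_def intro!: continuous_intros)
  have "(LBINT u:{-1..1}. (c * f (\<gamma> u) + d * g (\<gamma> u)) * (1 - u\<^sup>2) powr (\<mu> - 1/2)) =
      (LBINT u:{-1..1}. c * (f (\<gamma> u) * (1 - u\<^sup>2) powr (\<mu> - 1/2)) + d * (g (\<gamma> u) * (1 - u\<^sup>2) powr (\<mu> - 1/2)))"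
    by (simp add: algebra_simps)
  also have "\<dots> = c * (LBINT u:{-1..1}. f (\<gamma> u) * (1 - u\<^sup>2) powr (\<mu> - 1/2)) +
      d * (LBINT u:{-1..1}. g (\<gamma> u) * (1 - u\<^sup>2) powr (\<mu> - 1/2))"
    by (subst set_integral_add) (simp_all add: int f g)
  finally show ?thesis
    unfolding radon_rescale[OF t] \<gamma>_def by (simp add: algebra_simps)
qed

lemma integral_odd_weight:
  fixes h :: "real \<Rightarrow> real"
  assumes "\<And>u. h (- u) = - h u"
  shows "(LBINT u:{-1..1}. h u * (1 - u\<^sup>2) powr \<nu>) = 0"
proof -
  let ?F = "\<lambda>u. indicator {-1..1} u *\<^sub>R (h u * (1 - u\<^sup>2) powr \<nu>)"
  have "(\<integral>u. ?F u \<partial>lborel) = (\<integral>u. ?F (- u) \<partial>lborel)"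
    using lborel_integral_real_affine[of "-1" ?F 0] by simp
  also have "?F (- u) = - ?F u" for u
    by (auto simp: assms indicator_def)
  then have "(\<integral>u. ?F (- u) \<partial>lborel) = - (\<integral>u. ?F u \<partial>lborel)"
    by (simp only: Bochner_Integration.integral_minus)
  finally show ?thesis by (simp add: set_lebesgue_integral_def)
qed

text \<open>The bridge from the formal \<open>slice_int\<close> to actual chord integrals: s^j
  contributes sqrt (1 - t^2)^j, an integral power of 1 - t^2 for even j, while odd j contribute 0 on
  both sides.\<close>

lemma poly_slice_int:
  assumes mu: "\<mu> > -1/2" and t: "-1 < t" "t < 1"
  shows "poly (slice_int \<mu> F) t =
    (LBINT u:{-1..1}. bieval t (sqrt (1 - t\<^sup>2) * u) F * (1 - u\<^sup>2) powr (\<mu> - 1/2))"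
proof (induction F rule: bipoly_induct)
  case (monom a i j)
  have "(LBINT u:{-1..1}. bieval t (sqrt (1 - t\<^sup>2) * u) (monom (monom a i) j) * (1 - u\<^sup>2) powr (\<mu> - 1/2)) =
      (LBINT u:{-1..1}. (a * t ^ i * sqrt (1 - t\<^sup>2) ^ j) * (poly (monom 1 j) u * (1 - u\<^sup>2) powr (\<mu> - 1/2)))"
    by (simp add: bieval_def poly_monom power_mult_distrib mult_ac)
  also have "\<dots> = a * t ^ i * (sqrt (1 - t\<^sup>2) ^ j * moment (\<mu> - 1/2) j)"
    by (simp only: set_integral_mult_right gegenbauer_int_eq moment_def mult.assoc)
  also have "sqrt (1 - t\<^sup>2) ^ j * moment (\<mu> - 1/2) j = (1 - t\<^sup>2) ^ (j div 2) * moment (\<mu> - 1/2) j"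
  proof (cases "even j")
    case True
    have "1 - t\<^sup>2 \<ge> 0" using t by (simp add: abs_square_le_1 abs_le_iff)
    with True show ?thesis by (auto simp: power_mult elim!: evenE)
  qed (use mu in \<open>simp add: moment_odd\<close>)
  finally show ?case
    by (simp add: slice_int_monom poly_monom mult_ac power2_eq_square)
next
  case (add F G)
  have int: "set_integrable lborel {-1..1} (\<lambda>u. bieval t (sqrt (1 - t\<^sup>2) * u) H * (1 - u\<^sup>2) powr (\<mu> - 1/2))" for H
    unfolding bieval_def using mu
    by (intro set_integrable_continuous_times_weight set_integrable_one_minus_square_powr)
      (induction H, auto intro!: continuous_intros)
  show ?case
    unfolding slice_int_add poly_add add bieval_simps distrib_right by (subst set_integral_add) (auto simp: int)
qed

section \<open>The disk basis through powers of x + i y\<close>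

definition trig_part :: "nat \<Rightarrow> complex \<Rightarrow> real" where
  "trig_part \<epsilon> z = (if \<epsilon> = 0 then Re z else Im z)"

text \<open>This is h_{l,k} p_l(1), because \<open>jacobi_hyp\<close> has value 1 at 1;
  equivalently, the amplitude of the basis function on the unit circle.\<close>

definition basis_coef :: "real \<Rightarrow> nat \<Rightarrow> nat \<Rightarrow> real" where
  "basis_coef \<mu> k l = h_coef \<mu> l k / sqrt (jacobi_norm (\<mu> - 1/2) (real (k - 2 * l)) l)"

text \<open>By De Moivre, r^j cos (j phi) and r^j sin (j phi) are the parts of (x + i y)^j. The
  origin is no special case, since z = |z| cis (Arg z) holds there too.\<close>

lemma disk_basis_eq:
  assumes mu: "\<mu> > -1/2"
  shows "disk_basis \<mu> k l \<epsilon> (x, y) = basis_coef \<mu> k l *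
    poly (jacobi_hyp (\<mu> - 1/2) (real (k - 2 * l)) l) (2 * (x\<^sup>2 + y\<^sup>2) - 1) *
    trig_part \<epsilon> (Complex x y ^ (k - 2 * l))"
proof -
  let ?j = "k - 2 * l" and ?r = "sqrt (x\<^sup>2 + y\<^sup>2)" and ?\<phi> = "Arg (Complex x y)"
  have "Complex x y = complex_of_real ?r * cis ?\<phi>"
    using rcis_cmod_Arg[of "Complex x y"] by (simp add: rcis_def cmod_def)
  from arg_cong[OF this, of "\<lambda>z. z ^ ?j"]
  have "Complex x y ^ ?j = complex_of_real (?r ^ ?j) * cis (real ?j * ?\<phi>)"
    by (simp only: power_mult_distrib Complex.DeMoivre of_real_power)
  then have "trig_part \<epsilon> (Complex x y ^ ?j) = ?r ^ ?j * S_trig ?j \<epsilon> ?\<phi>"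
    by (simp add: trig_part_def S_trig_def)
  moreover have "jacobi_on (\<mu> - 1/2) (real ?j) l =
      smult (1 / sqrt (jacobi_norm (\<mu> - 1/2) (real ?j) l)) (jacobi_hyp (\<mu> - 1/2) (real ?j) l)"
    using mu by (intro jacobi_on_eq) auto
  ultimately show ?thesis
    unfolding disk_basis_def basis_coef_def Let_def by simp
qed

lemma disk_basis_circle:
  assumes mu: "\<mu> > -1/2"
  shows "disk_basis \<mu> k l \<epsilon> (cos \<xi>, sin \<xi>) = basis_coef \<mu> k l * S_trig (k - 2 * l) \<epsilon> \<xi>"
proof -
  have "Complex (cos \<xi>) (sin \<xi>) = cis \<xi>" by (simp add: complex_eq_iff)
  then have "Complex (cos \<xi>) (sin \<xi>) ^ (k - 2 * l) = cis (real (k - 2 * l) * \<xi>)"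
    by (simp only: Complex.DeMoivre)
  then show ?thesis
    by (simp add: disk_basis_eq[OF mu] trig_part_def S_trig_def)
qed

text \<open>The points of the chord are e^(i theta) (t + i s), so the angular factor splits into
  S_j(theta) Re z^j plus a multiple of Im z^j. The second part is odd in s and integrates to 0; the
  first is the chord integral already identified as a multiple of \<open>jacobi_hyp\<close>.\<close>

lemma radon_disk_basis:
  assumes mu: "\<mu> > -1/2" and t: "-1 < t" "t < 1" and l: "2 * l \<le> k"
  shows "radon \<mu> \<theta> (disk_basis \<mu> k l \<epsilon>) t = (1 - t\<^sup>2) powr \<mu> *
    (basis_coef \<mu> k l * S_trig (k - 2 * l) \<epsilon> \<theta> * moment (\<mu> - 1/2) 0 * poly (jacobi_hyp \<mu> \<mu> k) t)"
proof -
  define j where "j = k - 2 * l"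
  define \<sigma> where "\<sigma> = sqrt (1 - t\<^sup>2)"
  define g where "g = pcompose (jacobi_hyp (\<mu> - 1/2) (real j) l) [:-1, 2:]"
  \<comment> \<open>The coefficient of Im z^j in the corresponding part of e^(i j theta)
    z^j.\<close>
  define S' where "S' = (if \<epsilon> = 0 then - sin (real j * \<theta>) else cos (real j * \<theta>))"
  define I where "I = (\<lambda>h :: real \<Rightarrow> real. LBINT u:{-1..1}. h u * (1 - u\<^sup>2) powr (\<mu> - 1/2))"
  define A where "A = (\<lambda>u. bieval t (\<sigma> * u) (radial g * bicos j))"
  define B where "B = (\<lambda>u. bieval t (\<sigma> * u) (radial g * bisin j))"
  have val: "disk_basis \<mu> k l \<epsilon> (t * cos \<theta> - \<sigma> * u * sin \<theta>, t * sin \<theta> + \<sigma> * u * cos \<theta>) =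
      basis_coef \<mu> k l * (S_trig j \<epsilon> \<theta> * A u + S' * B u)" for u
  proof -
    let ?x = "t * cos \<theta> - \<sigma> * u * sin \<theta>" and ?y = "t * sin \<theta> + \<sigma> * u * cos \<theta>"
    have r: "?x\<^sup>2 + ?y\<^sup>2 = t\<^sup>2 + (\<sigma> * u)\<^sup>2" by (rule rotation_norm)
    have "Complex ?x ?y = cis \<theta> * Complex t (\<sigma> * u)"
      by (simp add: complex_eq_iff algebra_simps)
    then have "Complex ?x ?y ^ j = cis (real j * \<theta>) * Complex t (\<sigma> * u) ^ j"
      by (simp only: power_mult_distrib Complex.DeMoivre)
    then have "trig_part \<epsilon> (Complex ?x ?y ^ j) =
        S_trig j \<epsilon> \<theta> * bieval t (\<sigma> * u) (bicos j) + S' * bieval t (\<sigma> * u) (bisin j)"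
      by (simp add: trig_part_def S_trig_def S'_def bieval_bicos_bisin)
    then show ?thesis
      unfolding disk_basis_eq[OF mu] r j_def [symmetric] A_def B_def
      by (simp add: g_def poly_pcompose algebra_simps)
  qed
  have int: "set_integrable lborel {-1..1} (\<lambda>u. bieval t (\<sigma> * u) H * (1 - u\<^sup>2) powr (\<mu> - 1/2))" for H
    unfolding bieval_def using mu
    by (intro set_integrable_continuous_times_weight set_integrable_one_minus_square_powr)
      (induction H, auto intro!: continuous_intros)
  have "radon \<mu> \<theta> (disk_basis \<mu> k l \<epsilon>) t =
      (1 - t\<^sup>2) powr \<mu> * I (\<lambda>u. basis_coef \<mu> k l * (S_trig j \<epsilon> \<theta> * A u + S' * B u))"
    unfolding radon_rescale[OF t] \<sigma>_def [symmetric] val I_def ..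
  also have "I (\<lambda>u. basis_coef \<mu> k l * (S_trig j \<epsilon> \<theta> * A u + S' * B u)) =
      (LBINT u:{-1..1}. (basis_coef \<mu> k l * S_trig j \<epsilon> \<theta>) * (A u * (1 - u\<^sup>2) powr (\<mu> - 1/2)) +
         (basis_coef \<mu> k l * S') * (B u * (1 - u\<^sup>2) powr (\<mu> - 1/2)))"
    by (simp add: I_def algebra_simps)
  also have "\<dots> = basis_coef \<mu> k l * S_trig j \<epsilon> \<theta> * I A + basis_coef \<mu> k l * S' * I B"
    unfolding I_def A_def B_def
    by (subst set_integral_add) (auto intro!: set_integrable_mult_right int simp del: bieval_simps)
  also have "I B = 0"
    unfolding I_def
  proof (rule integral_odd_weight)
    fix u
    have "Complex t (\<sigma> * - u) = cnj (Complex t (\<sigma> * u))" by (simp add: complex_eq_iff)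
    then have "Im (Complex t (\<sigma> * - u) ^ j) = - Im (Complex t (\<sigma> * u) ^ j)"
      by (simp only: complex_cnj_power [symmetric] cnj.simps)
    then have "bieval t (\<sigma> * - u) (bisin j) = - bieval t (\<sigma> * u) (bisin j)"
      by (simp only: bieval_bicos_bisin)
    then show "B (- u) = - B u" by (simp add: B_def power_mult_distrib)
  qed
  also have "I A = poly (slice_int \<mu> (radial g * bicos j)) t"
    unfolding I_def A_def \<sigma>_def poly_slice_int[OF mu t] ..
  also have "slice_int \<mu> (radial g * bicos j) = smult (moment (\<mu> - 1/2) 0) (jacobi_hyp \<mu> \<mu> k)"
    using slice_int_radial_bicos[OF mu, of j l] l by (simp add: g_def j_def)
  finally show ?thesis by (simp add: j_def mult_ac)
qed

section \<open>Normalization constants\<close>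

text \<open>With j = k - 2l the Gamma quotient in h is (mu + 3/2)_j / j!. Splitting the symbols of
  length j + l after j factors shows that lambda_{l,k} is the reciprocal of this quotient times the
  Jacobi norm; d cancels against the 1 / d in h^2.\<close>

lemma lam_basis_coef:
  assumes mu: "\<mu> > -1/2" and l: "2 * l \<le> k"
  shows "lam_coef \<mu> l k * (basis_coef \<mu> k l)\<^sup>2 * d_coef l k = 1"
proof -
  obtain j where k: "k = j + 2 * l" using l by (metis add.commute le_Suc_ex)
  have d: "d_coef l k > 0" by (simp add: d_coef_def)
  have N: "jacobi_norm (\<mu> - 1/2) (real j) l > 0"
    using mu by (intro jacobi_norm_pos) auto
  have "\<mu> + 3/2 \<notin> \<int>\<^sub>\<le>\<^sub>0" using mu by (auto dest: nonpos_Ints_nonpos)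
  then have G: "Gamma (real j + \<mu> + 3/2) / (Gamma (\<mu> + 3/2) * Gamma (real j + 1)) = pochhammer (\<mu> + 3/2) j / fact j"
    using pochhammer_Gamma[of "\<mu> + 3/2" j] Gamma_fact[of j, where 'a = real]
    by (simp add: add_ac)
  have pos: "pochhammer (\<mu> + 3/2) i > 0" "pochhammer (\<mu> + 1/2) i > 0" "pochhammer (\<mu> + 3/2 + real j) i > 0"
    "pochhammer (real j + 1) i > 0" for i
    using mu by (auto intro!: pochhammer_pos)
  have "h_coef \<mu> l k ^ 2 = 1 / d_coef l k * (pochhammer (\<mu> + 3/2) j / fact j)"
    unfolding h_coef_def using G pos(1)[of j] d by (subst real_sqrt_pow2) (simp_all add: k)
  then have b: "(basis_coef \<mu> k l)\<^sup>2 * d_coef l k =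
      pochhammer (\<mu> + 3/2) j / fact j / jacobi_norm (\<mu> - 1/2) (real j) l"
    using d N by (simp add: basis_coef_def power_divide k)
  have p: "pochhammer (\<mu> + 3/2) (j + l) = pochhammer (\<mu> + 3/2) j * pochhammer (\<mu> + 3/2 + real j) l"
    by (simp add: pochhammer_product')
  have f: "fact (j + l) = fact j * pochhammer (real j + 1) l"
    using pochhammer_product'[of "1 :: real" j l] by (simp add: pochhammer_fact add_ac)
  have kl: "k - l = j + l" by (simp add: k)
  have nz: "real (j + l) + \<mu> + 1/2 > 0" "real k + \<mu> + 1/2 > 0" using mu by auto
  have n: "jacobi_norm (\<mu> - 1/2) (real j) l = fact l * pochhammer (real j + 1) l * (real (j + l) + \<mu> + 1/2) /
     (pochhammer (\<mu> + 1/2) l * pochhammer (\<mu> + 3/2 + real j) l * (real k + \<mu> + 1/2))"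
    by (simp add: jacobi_norm_def k algebra_simps)
  have "lam_coef \<mu> l k * ((basis_coef \<mu> k l)\<^sup>2 * d_coef l k) = 1"
    unfolding b n lam_coef_def kl p f
    using pos(1)[of j] pos(2)[of l] pos(3)[of l] pos(4)[of l] nz by (simp add: divide_simps)
  then show ?thesis by (simp add: mult.assoc)
qed

text \<open>Explains the factor in \<open>Phi_ker\<close>: it turns C_k into the polynomial with
  value 1 at 1 divided by its squared norm, so that integration against that same polynomial leaves
  exactly the total mass.\<close>

lemma gegenbauer_jacobi_norm:
  assumes mu: "\<mu> > -1/2"
  shows "(real k + \<mu> + 1/2) / (\<mu> + 1/2) * poly (gegenbauer (\<mu> + 1/2) k) t =
    poly (jacobi_hyp \<mu> \<mu> k) t / jacobi_norm \<mu> \<mu> k"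
proof -
  have pos: "pochhammer (2 * \<mu> + 2) k > 0" "pochhammer (\<mu> + 1) k > 0" "2 * \<mu> + 1 + real k > 0" "\<mu> + 1/2 > 0"
    "2 * \<mu> + 2 * real k + 1 > 0" using mu by (auto intro!: pochhammer_pos)
  have "(2 * \<mu> + 1) * pochhammer (2 * \<mu> + 2) k = pochhammer (2 * \<mu> + 1) k * (2 * \<mu> + 1 + real k)"
    using pochhammer_rec[of "2 * \<mu> + 1" k] pochhammer_rec'[of "2 * \<mu> + 1" k] by (simp add: mult_ac add_ac)
  then have p: "pochhammer (2 * \<mu> + 1) k = (2 * \<mu> + 1) * pochhammer (2 * \<mu> + 2) k / (2 * \<mu> + 1 + real k)"
    using pos by (simp add: field_simps)
  have n: "jacobi_norm \<mu> \<mu> k = fact k * (2 * \<mu> + 1 + real k) / (pochhammer (2 * \<mu> + 2) k * (2 * \<mu> + 2 * real k + 1))"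
    using pos(2) by (simp add: jacobi_norm_def add_ac)
  have e: "2 * (\<mu> + 1/2) = 2 * \<mu> + 1" "(real k + \<mu> + 1/2) / (\<mu> + 1/2) = (2 * \<mu> + 2 * real k + 1) / (2 * \<mu> + 1)"
    using pos by (simp_all add: field_simps)
  have "(2 * \<mu> + 2 * real k + 1) / (2 * \<mu> + 1) * (pochhammer (2 * \<mu> + 1) k / fact k) = 1 / jacobi_norm \<mu> \<mu> k"
    unfolding p n using pos by (simp add: divide_simps)
  then show ?thesis
    using mu by (simp add: gegenbauer_eq e) (metis times_divide_eq_left mult.assoc mult_1)
qed

text \<open>The mass of the disk is the mass of a rescaled chord times that of (1 - t^2)^mu. Both
  are Beta values, and the duplication formula evaluates the product Gamma(mu + 1/2) Gamma(mu + 1)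
  that they contain.\<close>

lemma total_mass:
  assumes mu: "\<mu> > -1/2"
  shows "a_const \<mu> * moment (\<mu> - 1/2) 0 * jacobi_int \<mu> \<mu> 1 = 1"
proof -
  have "complex_of_real (Gamma (\<mu> + 1/2) * Gamma (\<mu> + 1)) =
      complex_of_real (2 powr (- 2 * \<mu>) * sqrt pi * Gamma (2 * \<mu> + 1))"
  proof -
    let ?z = "complex_of_real (\<mu> + 1/2)"
    have nz: "?z \<notin> \<int>\<^sub>\<le>\<^sub>0" "?z + 1/2 \<notin> \<int>\<^sub>\<le>\<^sub>0"
      using mu by (auto elim!: nonpos_Ints_cases simp: complex_eq_iff)
    have "Gamma ?z * Gamma (?z + 1/2) = exp ((1 - 2 * ?z) * of_real (ln 2)) * of_real (sqrt pi) * Gamma (2 * ?z)"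
      by (rule Gamma_legendre_duplication[OF nz])
    moreover have "?z + 1/2 = complex_of_real (\<mu> + 1)" "2 * ?z = complex_of_real (2 * \<mu> + 1)"
      "(1 - 2 * ?z) * of_real (ln 2) = complex_of_real (- 2 * \<mu> * ln 2)" by (simp_all add: algebra_simps)
    ultimately show ?thesis
      by (simp only: Gamma_complex_of_real exp_of_real of_real_mult [symmetric]) (simp add: powr_def)
  qed
  then have dup: "Gamma (\<mu> + 1/2) * Gamma (\<mu> + 1) = 2 powr (- 2 * \<mu>) * sqrt pi * Gamma (2 * \<mu> + 1)"
    by (simp only: of_real_eq_iff)
  have G: "Gamma (2 * \<mu> + 1) > 0" "Gamma (2 * \<mu> + 2) = (2 * \<mu> + 1) * Gamma (2 * \<mu> + 1)"
    using mu Gamma_plus1[of "2 * \<mu> + 1"] nonpos_Ints_nonpos[of "2 * \<mu> + 1"]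
    by (auto simp: Gamma_real_pos add_ac)
  have "moment (\<mu> - 1/2) 0 * jacobi_int \<mu> \<mu> 1 =
      2 powr (2 * \<mu>) * 2 powr (2 * \<mu> + 1) * (Gamma (\<mu> + 1/2) * Gamma (\<mu> + 1))\<^sup>2 / (Gamma (2 * \<mu> + 1) * Gamma (2 * \<mu> + 2))"
    using mu by (simp add: moment_def monom_0 jacobi_int_1 Beta_def power2_eq_square add_ac flip: one_pCons mult_2)
  also have "\<dots> = 2 * pi / (2 * \<mu> + 1)"
  proof -
    define P where "P = 2 powr (2 * \<mu>)"
    have "P > 0" "2 powr (2 * \<mu> + 1) = 2 * P" "2 powr (- 2 * \<mu>) = 1 / P"
      by (simp_all add: P_def powr_add powr_minus field_simps)
    then show ?thesis
      using G(1) unfolding dup G(2) P_def [symmetric]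
      by (simp add: power_mult_distrib power_divide power2_eq_square)
  qed
  finally show ?thesis using mu by (simp add: a_const_def field_simps)
qed

section \<open>Polynomials in two variables\<close>

lemma Pi2_I: "(\<And>x y. P (x, y) = (\<Sum>i\<le>n. \<Sum>j\<le>n - i. c i j * x ^ i * y ^ j)) \<Longrightarrow> P \<in> Pi2 n"
  unfolding Pi2_def by blast

lemma Pi2_E:
  assumes "P \<in> Pi2 n"
  obtains c where "\<forall>x y. P (x, y) = (\<Sum>i\<le>n. \<Sum>j\<le>n - i. c i j * x ^ i * y ^ j)"
  using assms unfolding Pi2_def by blast

lemma Pi2_add:
  assumes "P \<in> Pi2 n" "Q \<in> Pi2 n"
  shows "(\<lambda>z. P z + Q z) \<in> Pi2 n"
proof -
  obtain c where "\<forall>x y. P (x, y) = (\<Sum>i\<le>n. \<Sum>j\<le>n - i. c i j * x ^ i * y ^ j)"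
    using assms(1) by (rule Pi2_E)
  moreover obtain d where "\<forall>x y. Q (x, y) = (\<Sum>i\<le>n. \<Sum>j\<le>n - i. d i j * x ^ i * y ^ j)"
    using assms(2) by (rule Pi2_E)
  ultimately show ?thesis
    by (intro Pi2_I[where c = "\<lambda>i j. c i j + d i j"]) (simp add: sum.distrib distrib_right)
qed

lemma Pi2_scale:
  assumes "P \<in> Pi2 n"
  shows "(\<lambda>z. a * P z) \<in> Pi2 n"
proof -
  obtain c where "\<forall>x y. P (x, y) = (\<Sum>i\<le>n. \<Sum>j\<le>n - i. c i j * x ^ i * y ^ j)"
    using assms by (rule Pi2_E)
  then show ?thesis
    by (intro Pi2_I[where c = "\<lambda>i j. a * c i j"]) (simp add: sum_distrib_left mult.assoc)
qed

lemma Pi2_Suc: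
  assumes "P \<in> Pi2 n"
  shows "P \<in> Pi2 (Suc n)"
proof -
  obtain c where c: "\<forall>x y. P (x, y) = (\<Sum>i\<le>n. \<Sum>j\<le>n - i. c i j * x ^ i * y ^ j)"
    using assms by (rule Pi2_E)
  show ?thesis
  proof (rule Pi2_I[where c = "\<lambda>i j. if i + j \<le> n then c i j else 0"])
    fix x y :: real
    show "P (x, y) = (\<Sum>i\<le>Suc n. \<Sum>j\<le>Suc n - i. (if i + j \<le> n then c i j else 0) * x ^ i * y ^ j)"
    proof -
      have "(\<Sum>j\<le>Suc n - i. (if i + j \<le> n then c i j else 0) * x ^ i * y ^ j) =
          (\<Sum>j\<le>n - i. c i j * x ^ i * y ^ j)" if "i \<le> n" for i
        using that by (intro sum.mono_neutral_cong_right) auto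
      then show ?thesis by (simp add: c)
    qed
  qed
qed

lemma Pi2_mono: "P \<in> Pi2 m \<Longrightarrow> m \<le> n \<Longrightarrow> P \<in> Pi2 n"
  by (rotate_tac, induction n rule: dec_induct) (auto intro: Pi2_Suc)

lemma Pi2_const: "(\<lambda>z. a) \<in> Pi2 n"
  by (rule Pi2_mono[of _ 0]) (auto intro!: Pi2_I[where c = "\<lambda>i j. a"])

lemma Pi2_mult_fst:
  assumes "P \<in> Pi2 n"
  shows "(\<lambda>z. fst z * P z) \<in> Pi2 (Suc n)"
proof -
  obtain c where c: "\<forall>x y. P (x, y) = (\<Sum>i\<le>n. \<Sum>j\<le>n - i. c i j * x ^ i * y ^ j)"
    using assms by (rule Pi2_E)
  show ?thesis
    by (rule Pi2_I[where c = "\<lambda>i j. case i of 0 \<Rightarrow> 0 | Suc i \<Rightarrow> c i j"])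
      (simp add: c sum.atMost_Suc_shift sum_distrib_left mult_ac del: sum.atMost_Suc)
qed

lemma Pi2_mult_snd:
  assumes "P \<in> Pi2 n"
  shows "(\<lambda>z. snd z * P z) \<in> Pi2 (Suc n)"
proof -
  obtain c where c: "\<forall>x y. P (x, y) = (\<Sum>i\<le>n. \<Sum>j\<le>n - i. c i j * x ^ i * y ^ j)"
    using assms by (rule Pi2_E)
  show ?thesis
  proof (rule Pi2_I[where c = "\<lambda>i j. case j of 0 \<Rightarrow> 0 | Suc j \<Rightarrow> c i j"])
    fix x y :: real
    \<comment> \<open>The row i = n + 1 has only the entry j = 0, whose coefficient is 0, and may be
      dropped.\<close>
    have "(\<Sum>i\<le>Suc n. \<Sum>j\<le>Suc n - i. (case j of 0 \<Rightarrow> 0 | Suc j \<Rightarrow> c i j) * x ^ i * y ^ j) =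
        (\<Sum>i\<le>n. \<Sum>j\<le>Suc (n - i). (case j of 0 \<Rightarrow> 0 | Suc j \<Rightarrow> c i j) * x ^ i * y ^ j)"
      by (simp add: Suc_diff_le)
    also have "\<dots> = y * P (x, y)"
      by (simp add: c sum.atMost_Suc_shift sum_distrib_left mult_ac del: sum.atMost_Suc)
    finally show "snd (x, y) * P (x, y) =
        (\<Sum>i\<le>Suc n. \<Sum>j\<le>Suc n - i. (case j of 0 \<Rightarrow> 0 | Suc j \<Rightarrow> c i j) * x ^ i * y ^ j)" by simp
  qed
qed

lemma Pi2_sum: "(\<And>i. i \<in> I \<Longrightarrow> P i \<in> Pi2 n) \<Longrightarrow> (\<lambda>z. \<Sum>i\<in>I. P i z) \<in> Pi2 n"
  by (induction I rule: infinite_finite_induct) (auto intro: Pi2_const Pi2_add)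

lemma Pi2_trig_part:
  "(\<lambda>z. trig_part \<epsilon> (Complex (fst z) (snd z) ^ j)) \<in> Pi2 j"
proof -
  have "(\<lambda>z. Re (Complex (fst z) (snd z) ^ j)) \<in> Pi2 j \<and> (\<lambda>z. Im (Complex (fst z) (snd z) ^ j)) \<in> Pi2 j"
  proof (induction j)
    case 0
    show ?case by (simp add: Pi2_const)
  next
    case (Suc j)
    then have "(\<lambda>z. fst z * Re (Complex (fst z) (snd z) ^ j) + (-1) * (snd z * Im (Complex (fst z) (snd z) ^ j))) \<in> Pi2 (Suc j)"
      "(\<lambda>z. fst z * Im (Complex (fst z) (snd z) ^ j) + snd z * Re (Complex (fst z) (snd z) ^ j)) \<in> Pi2 (Suc j)"
      by (intro Pi2_add Pi2_scale Pi2_mult_fst Pi2_mult_snd; simp)+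
    then show ?case by simp
  qed
  then show ?thesis by (cases "\<epsilon> = 0") (auto simp: trig_part_def)
qed

lemma Pi2_radial:
  assumes "P \<in> Pi2 j" "degree g \<le> l"
  shows "(\<lambda>z. poly g ((fst z)\<^sup>2 + (snd z)\<^sup>2) * P z) \<in> Pi2 (j + 2 * l)"
  using assms(2)
proof (induction l arbitrary: g)
  case 0
  then obtain a where "g = [:a:]" by (metis le_zero_eq degree_eq_zeroE)
  with assms(1) show ?case by (simp add: Pi2_scale)
next
  case (Suc l)
  obtain a h where g: "g = pCons a h" by (cases g)
  have "degree h \<le> l" using Suc.prems by (cases "h = 0") (auto simp: g)
  define H where "H = (\<lambda>z. poly h ((fst z)\<^sup>2 + (snd z)\<^sup>2) * P z)"
  have H: "H \<in> Pi2 (j + 2 * l)" unfolding H_def by (rule Suc.IH) fact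
  have "(\<lambda>z. (fst z * (fst z * H z) + snd z * (snd z * H z)) + a * P z) \<in> Pi2 (Suc (Suc (j + 2 * l)))"
    by (intro Pi2_add Pi2_mult_fst Pi2_mult_snd H Pi2_scale Pi2_mono[OF assms(1)]) auto
  moreover have "(\<lambda>z. poly g ((fst z)\<^sup>2 + (snd z)\<^sup>2) * P z) =
      (\<lambda>z. (fst z * (fst z * H z) + snd z * (snd z * H z)) + a * P z)"
    by (auto simp: g H_def power2_eq_square algebra_simps)
  ultimately show ?case by simp
qed

lemma disk_basis_altdef:
  assumes mu: "\<mu> > -1/2"
  shows "disk_basis \<mu> k l \<epsilon> = (\<lambda>z. basis_coef \<mu> k l *
    (poly (pcompose (jacobi_hyp (\<mu> - 1/2) (real (k - 2 * l)) l) [:-1, 2:]) ((fst z)\<^sup>2 + (snd z)\<^sup>2) *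
     trig_part \<epsilon> (Complex (fst z) (snd z) ^ (k - 2 * l))))"
proof (rule ext, clarify)
  fix x y :: real
  show "disk_basis \<mu> k l \<epsilon> (x, y) = basis_coef \<mu> k l *
    (poly (pcompose (jacobi_hyp (\<mu> - 1/2) (real (k - 2 * l)) l) [:-1, 2:]) ((fst (x, y))\<^sup>2 + (snd (x, y))\<^sup>2) *
     trig_part \<epsilon> (Complex (fst (x, y)) (snd (x, y)) ^ (k - 2 * l)))"
    unfolding disk_basis_eq[OF mu] by (simp add: poly_pcompose algebra_simps)
qed

lemma disk_basis_in_Pi2:
  assumes mu: "\<mu> > -1/2" and "2 * l \<le> k"
  shows "disk_basis \<mu> k l \<epsilon> \<in> Pi2 k"
proof -
  have "disk_basis \<mu> k l \<epsilon> \<in> Pi2 (k - 2 * l + 2 * l)"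
    unfolding disk_basis_altdef[OF mu]
    by (intro Pi2_scale Pi2_radial Pi2_trig_part) (simp add: degree_pcompose degree_jacobi_hyp_le)
  with assms(2) show ?thesis by simp
qed

lemma continuous_on_Pi2:
  assumes "P \<in> Pi2 n"
  shows "continuous_on S P"
proof -
  obtain c where "\<forall>x y. P (x, y) = (\<Sum>i\<le>n. \<Sum>j\<le>n - i. c i j * x ^ i * y ^ j)"
    using assms by (rule Pi2_E)
  then have "P = (\<lambda>z. \<Sum>i\<le>n. \<Sum>j\<le>n - i. c i j * fst z ^ i * snd z ^ j)" by auto
  then show ?thesis by (simp only:) (intro continuous_intros)
qed

text \<open>The members of a linear space Z that contains the basis up to degree n: monomials are
  written in z and cnj z, whose products are radial factors times powers of z or cnj z.\<close>
locale contains_disk_basis =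
  fixes \<mu> :: real and n :: nat and Z :: "(real \<times> real \<Rightarrow> real) set"
  assumes mu: "\<mu> > -1/2"
    and add: "\<And>P Q. P \<in> Z \<Longrightarrow> Q \<in> Z \<Longrightarrow> (\<lambda>z. P z + Q z) \<in> Z"
    and scale: "\<And>a P. P \<in> Z \<Longrightarrow> (\<lambda>z. a * P z) \<in> Z"
    and basis: "\<And>k l \<epsilon>. k \<le> n \<Longrightarrow> (l, \<epsilon>) \<in> admissible k \<Longrightarrow> disk_basis \<mu> k l \<epsilon> \<in> Z"
begin

lemma zero: "(\<lambda>z. 0) \<in> Z"
  using scale[OF basis[of 0 0 0], of 0] by (simp add: admissible_def)

text \<open>Frequency j occurs in the basis with one radial polynomial of each degree d, at k = j +
  2d, so leading terms can be cancelled one after another. The pair j = 0, epsilon = 1 is not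
  admissible, but its angular factor is Im 1 = 0.\<close>

lemma radial_trig:
  assumes "j + 2 * degree q \<le> n" "\<epsilon> \<in> {0, 1}"
  shows "(\<lambda>z. poly q ((fst z)\<^sup>2 + (snd z)\<^sup>2) * trig_part \<epsilon> (Complex (fst z) (snd z) ^ j)) \<in> Z"
proof (cases "j = 0 \<and> \<epsilon> = 1")
  case True
  then show ?thesis using zero by (simp add: trig_part_def)
next
  case nz: False
  show ?thesis using assms(1)
  proof (induction "degree q" arbitrary: q rule: less_induct)
    case less
    define d where "d = degree q"
    define k where "k = j + 2 * d"
    define h where "h = pcompose (jacobi_hyp (\<mu> - 1/2) (real j) d) [:-1, 2:]"
    define b where "b = coeff q d / coeff h d"
    have ab: "\<mu> - 1/2 > -1" "real j > -1" using mu by auto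
    have dh: "degree h = d" by (simp add: h_def degree_pcompose degree_jacobi_hyp[OF ab])
    have "h \<noteq> 0"
      using coeff_jacobi_hyp_pos[OF ab, of d] by (auto simp: h_def pcompose_eq_0_iff)
    then have ch: "coeff h d \<noteq> 0" using dh by auto
    \<comment> \<open>A product with value 1 has no zero factor.\<close>
    have B: "basis_coef \<mu> k d \<noteq> 0"
      using lam_basis_coef[OF mu, of d k] by (auto simp: k_def)
    have adm: "(d, \<epsilon>) \<in> admissible k" using nz assms(2) by (auto simp: admissible_def k_def)
    have hZ: "(\<lambda>z. poly h ((fst z)\<^sup>2 + (snd z)\<^sup>2) * trig_part \<epsilon> (Complex (fst z) (snd z) ^ j)) \<in> Z"
    proof -
      have "(\<lambda>z. 1 / basis_coef \<mu> k d * disk_basis \<mu> k d \<epsilon> z) \<in> Z"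
        using less.prems by (intro scale basis adm) (simp add: k_def d_def)
      then show ?thesis using B unfolding disk_basis_altdef[OF mu] by (simp add: k_def h_def)
    qed
    define r where "r = q - smult b h"
    have "degree r \<le> d" "coeff r d = 0"
      using ch unfolding r_def b_def
      by (auto simp: dh d_def intro!: degree_diff_le order.trans[OF degree_smult_le])
    then consider "r = 0" | "degree r < d" using degree_less_or_0 by blast
    then have "(\<lambda>z. poly r ((fst z)\<^sup>2 + (snd z)\<^sup>2) * trig_part \<epsilon> (Complex (fst z) (snd z) ^ j)) \<in> Z"
    proof cases
      case 2
      then show ?thesis using less.prems by (intro less.hyps) (auto simp: d_def)
    qed (simp add: zero)
    from add[OF this scale[OF hZ, of b]] show ?case
      by (simp add: r_def algebra_simps)
  qed
qed

text \<open>Z is a real space; asking for both parts makes the condition stable under complex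
  scalars and conjugation, as expansions in z and cnj z require.\<close>

definition both_parts :: "(real \<times> real \<Rightarrow> complex) \<Rightarrow> bool" where
  "both_parts f \<longleftrightarrow> (\<lambda>z. Re (f z)) \<in> Z \<and> (\<lambda>z. Im (f z)) \<in> Z"

lemma both_parts_add: "both_parts f \<Longrightarrow> both_parts g \<Longrightarrow> both_parts (\<lambda>z. f z + g z)"
  by (simp add: both_parts_def add)

lemma both_parts_scale:
  assumes "both_parts f"
  shows "both_parts (\<lambda>z. c * f z)"
proof -
  have "(\<lambda>z. Re c * Re (f z) + (- Im c) * Im (f z)) \<in> Z" "(\<lambda>z. Re c * Im (f z) + Im c * Re (f z)) \<in> Z"
    using assms unfolding both_parts_def by (intro add scale; simp)+
  then show ?thesis by (simp add: both_parts_def)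
qed

lemma both_parts_cnj: "both_parts f \<Longrightarrow> both_parts (\<lambda>z. cnj (f z))"
  using scale[of "\<lambda>z. Im (f z)" "-1"] by (simp add: both_parts_def)

text \<open>Pairing z with its conjugate as often as possible leaves a power of rho times a power of
  z alone; if conjugates prevail, the whole is conjugated.\<close>

lemma both_parts_power:
  assumes "a + b \<le> n"
  shows "both_parts (\<lambda>z. Complex (fst z) (snd z) ^ a * cnj (Complex (fst z) (snd z)) ^ b)"
proof -
  have *: "both_parts (\<lambda>z. Complex (fst z) (snd z) ^ (j + b) * cnj (Complex (fst z) (snd z)) ^ b)"
    if "j + 2 * b \<le> n" for j b
  proof -
    have "Complex x y ^ (j + b) * cnj (Complex x y) ^ b = complex_of_real ((x\<^sup>2 + y\<^sup>2) ^ b) * Complex x y ^ j" for x y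
    proof -
      have "Complex x y * cnj (Complex x y) = complex_of_real (x\<^sup>2 + y\<^sup>2)"
        by (simp add: complex_eq_iff power2_eq_square)
      then have "complex_of_real ((x\<^sup>2 + y\<^sup>2) ^ b) = Complex x y ^ b * cnj (Complex x y) ^ b"
        by (simp only: power_mult_distrib [symmetric] of_real_power)
      then show ?thesis by (simp add: power_add mult_ac)
    qed
    then show ?thesis
      using radial_trig[of j "monom 1 b" 0] radial_trig[of j "monom 1 b" 1] that
      by (simp add: both_parts_def trig_part_def poly_monom degree_monom_eq)
  qed
  show ?thesis
  proof (cases "b \<le> a")
    case True
    with *[of "a - b" b] assms show ?thesis by simp
  next
    case False
    with both_parts_cnj[OF *[of "b - a" a]] assms show ?thesis by (simp add: mult.commute)
  qed
qed

text \<open>The factors x and y are exchanged one at a time for combinations of z and cnj z. The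
  exponents a and b collect what has been exchanged, and the total degree is preserved.\<close>

lemma both_parts_monomial:
  "p + q + a + b \<le> n \<Longrightarrow> both_parts (\<lambda>z. complex_of_real (fst z ^ p * snd z ^ q) *
     (Complex (fst z) (snd z) ^ a * cnj (Complex (fst z) (snd z)) ^ b))"
proof (induction p arbitrary: a b)
  case 0
  then show ?case
  proof (induction q arbitrary: a b)
    case 0
    then show ?case using both_parts_power[of a b] by simp
  next
    case (Suc q)
    have e: "complex_of_real y = (- \<i> / 2) * Complex x y + (\<i> / 2) * cnj (Complex x y)" for x y
      by (simp add: complex_eq_iff)
    have "both_parts (\<lambda>z.
      (- \<i> / 2) * (complex_of_real (fst z ^ 0 * snd z ^ q) * (Complex (fst z) (snd z) ^ Suc a * cnj (Complex (fst z) (snd z)) ^ b)) +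
      (\<i> / 2) * (complex_of_real (fst z ^ 0 * snd z ^ q) * (Complex (fst z) (snd z) ^ a * cnj (Complex (fst z) (snd z)) ^ Suc b)))"
      using Suc.prems by (intro both_parts_add both_parts_scale Suc.IH) auto
    also have "(\<lambda>z.
      (- \<i> / 2) * (complex_of_real (fst z ^ 0 * snd z ^ q) * (Complex (fst z) (snd z) ^ Suc a * cnj (Complex (fst z) (snd z)) ^ b)) +
      (\<i> / 2) * (complex_of_real (fst z ^ 0 * snd z ^ q) * (Complex (fst z) (snd z) ^ a * cnj (Complex (fst z) (snd z)) ^ Suc b))) =
      (\<lambda>z. complex_of_real (snd z) * (complex_of_real (fst z ^ 0 * snd z ^ q) * (Complex (fst z) (snd z) ^ a * cnj (Complex (fst z) (snd z)) ^ b)))"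
      by (rule ext, subst e[of "snd z" "fst z" for z]) (simp only: power_Suc algebra_simps)
    finally show ?case by (simp only: power_Suc of_real_mult mult_ac)
  qed
next
  case (Suc p)
  have e: "complex_of_real x = (1 / 2) * Complex x y + (1 / 2) * cnj (Complex x y)" for x y
    by (simp add: complex_eq_iff)
  have "both_parts (\<lambda>z.
    (1 / 2) * (complex_of_real (fst z ^ p * snd z ^ q) * (Complex (fst z) (snd z) ^ Suc a * cnj (Complex (fst z) (snd z)) ^ b)) +
    (1 / 2) * (complex_of_real (fst z ^ p * snd z ^ q) * (Complex (fst z) (snd z) ^ a * cnj (Complex (fst z) (snd z)) ^ Suc b)))"
    using Suc.prems by (intro both_parts_add both_parts_scale Suc.IH) auto
  also have "(\<lambda>z.
    (1 / 2) * (complex_of_real (fst z ^ p * snd z ^ q) * (Complex (fst z) (snd z) ^ Suc a * cnj (Complex (fst z) (snd z)) ^ b)) +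
    (1 / 2) * (complex_of_real (fst z ^ p * snd z ^ q) * (Complex (fst z) (snd z) ^ a * cnj (Complex (fst z) (snd z)) ^ Suc b))) =
    (\<lambda>z. complex_of_real (fst z) * (complex_of_real (fst z ^ p * snd z ^ q) * (Complex (fst z) (snd z) ^ a * cnj (Complex (fst z) (snd z)) ^ b)))"
    by (rule ext, subst e[of "fst z" "snd z" for z]) (simp only: power_Suc algebra_simps)
  finally show ?case by (simp only: power_Suc of_real_mult mult_ac)
qed

lemma sum_mem: "(\<And>i. i \<in> I \<Longrightarrow> P i \<in> Z) \<Longrightarrow> (\<lambda>z. \<Sum>i\<in>I. P i z) \<in> Z"
  by (induction I rule: infinite_finite_induct) (auto intro: zero add)

lemma Pi2_subset: "Pi2 n \<subseteq> Z"
proof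
  fix P assume "P \<in> Pi2 n"
  then obtain c where "\<forall>x y. P (x, y) = (\<Sum>i\<le>n. \<Sum>j\<le>n - i. c i j * x ^ i * y ^ j)"
    by (rule Pi2_E)
  then have "P = (\<lambda>z. \<Sum>i\<le>n. \<Sum>j\<le>n - i. c i j * (fst z ^ i * snd z ^ j))" by (auto simp: mult.assoc)
  moreover have "(\<lambda>z. fst z ^ i * snd z ^ j) \<in> Z" if "i + j \<le> n" for i j
    using both_parts_monomial[of i j 0 0] that by (simp add: both_parts_def)
  then have "(\<lambda>z. \<Sum>i\<le>n. \<Sum>j\<le>n - i. c i j * (fst z ^ i * snd z ^ j)) \<in> Z"
    by (intro sum_mem scale) auto
  ultimately show "P \<in> Z" by simp
qed

end

section \<open>Discrete orthogonality and reproduction\<close>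

text \<open>Frequencies of equal parity have an even sum and difference, hence the angles 2 m xi.\<close>
lemma sum_cis_xi_angle:
  assumes "0 < m" "m \<le> n"
  shows "(\<Sum>\<nu>\<le>n. cis (2 * real m * xi_angle n \<nu>)) = 0"
proof -
  let ?z = "cis (2 * pi * real m / (real n + 1))"
  have "?z \<noteq> 1"
  proof
    assume "?z = 1"
    then have "cos (2 * pi * real m / (real n + 1)) = 1" by (simp add: complex_eq_iff)
    then obtain i :: int where "2 * pi * real m / (real n + 1) = i * 2 * pi"
      by (auto simp: cos_one_2pi_int)
    then have "2 * pi * real m = 2 * pi * (real_of_int i * (real n + 1))"
      by (simp add: divide_eq_eq mult_ac)
    then have "real m = real_of_int i * (real n + 1)" by (subst (asm) mult_cancel_left) simp
    then have "int m = i * int (n + 1)" by (metis of_int_eq_iff of_int_mult of_int_of_nat_eq of_nat_1 of_nat_add)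
    then have "int (n + 1) dvd int m" by simp
    then show False using assms by (auto dest!: zdvd_imp_le)
  qed
  moreover have "?z ^ Suc n = 1"
  proof -
    have "?z ^ Suc n = cis (real (Suc n) * (2 * pi * real m / (real n + 1)))"
      by (rule Complex.DeMoivre)
    also have "real (Suc n) * (2 * pi * real m / (real n + 1)) = 2 * pi * real m" by (simp add: field_simps)
    finally show ?thesis by (simp add: cis_multiple_2pi)
  qed
  moreover have "(\<Sum>\<nu>\<le>n. cis (2 * real m * xi_angle n \<nu>)) = (\<Sum>\<nu><Suc n. ?z ^ \<nu>)"
    by (simp add: Complex.DeMoivre xi_angle_def lessThan_Suc_atMost mult_ac)
  ultimately show ?thesis using geometric_sum[of ?z "Suc n"] by (simp only: diff_self div_0 not_False_eq_True)
qed

text \<open>An integer m is used because half the difference of two frequencies can be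
  negative.\<close>

lemma sum_cos_xi_angle:
  assumes "\<bar>m\<bar> \<le> int n"
  shows "(\<Sum>\<nu>\<le>n. cos (2 * real_of_int m * xi_angle n \<nu>)) = (if m = 0 then real n + 1 else 0)"
proof (cases "m = 0")
  case False
  have "real_of_int m = real (nat \<bar>m\<bar>) \<or> real_of_int m = - real (nat \<bar>m\<bar>)" by auto
  then have "cos (2 * real_of_int m * x) = Re (cis (2 * real (nat \<bar>m\<bar>) * x))" for x by auto
  then have "(\<Sum>\<nu>\<le>n. cos (2 * real_of_int m * xi_angle n \<nu>)) =
      Re (\<Sum>\<nu>\<le>n. cis (2 * real (nat \<bar>m\<bar>) * xi_angle n \<nu>))" by (simp only: Re_sum)
  also have "\<dots> = 0" using assms False by (subst sum_cis_xi_angle) auto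
  finally show ?thesis using False by simp
qed simp

lemma sum_sin_xi_angle:
  assumes "\<bar>m\<bar> \<le> int n"
  shows "(\<Sum>\<nu>\<le>n. sin (2 * real_of_int m * xi_angle n \<nu>)) = 0"
proof (cases "m = 0")
  case False
  have "real_of_int m = of_int (sgn m) * real (nat \<bar>m\<bar>)" by (auto simp: sgn_if)
  then have "sin (2 * real_of_int m * x) = of_int (sgn m) * Im (cis (2 * real (nat \<bar>m\<bar>) * x))" for x
    using False by (auto simp: sgn_if split: if_splits)
  then have "(\<Sum>\<nu>\<le>n. sin (2 * real_of_int m * xi_angle n \<nu>)) =
      of_int (sgn m) * Im (\<Sum>\<nu>\<le>n. cis (2 * real (nat \<bar>m\<bar>) * xi_angle n \<nu>))"
    by (simp only: Im_sum sum_distrib_left)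
  also have "\<dots> = 0" using assms False by (subst sum_cis_xi_angle) auto
  finally show ?thesis .
qed simp

text \<open>The product formulas give angles 2p xi and 2q xi, where p and q are half the difference
  and half the sum of the frequencies, at most n in absolute value. Here p = 0 means l = l', while q
  = 0 needs both frequencies to be 0; then two halves add up, which accounts for d = 1 instead of
  1/2.\<close>

lemma sum_S_trig_xi_angle:
  assumes "k \<le> n" "(l, \<epsilon>) \<in> admissible k" "(l', \<epsilon>') \<in> admissible k"
  shows "(\<Sum>\<nu>\<le>n. S_trig (k - 2 * l) \<epsilon> (xi_angle n \<nu>) * S_trig (k - 2 * l') \<epsilon>' (xi_angle n \<nu>)) =
    (if l = l' \<and> \<epsilon> = \<epsilon>' then (real n + 1) * d_coef l k else 0)"
proof -
  define p where "p = int l' - int l"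
  define q where "q = int k - int l - int l'"
  let ?j = "real (k - 2 * l)" and ?j' = "real (k - 2 * l')"
  have le: "2 * l + \<epsilon> \<le> k" "2 * l' + \<epsilon>' \<le> k" "\<epsilon> \<in> {0, 1}" "\<epsilon>' \<in> {0, 1}"
    using assms(2,3) by (auto simp: admissible_def)
  have j: "?j - ?j' = 2 * real_of_int p" "?j + ?j' = 2 * real_of_int q"
    using le by (auto simp: p_def q_def)
  have pq: "\<bar>p\<bar> \<le> int n" "\<bar>q\<bar> \<le> int n" using le assms(1) by (auto simp: p_def q_def)
  have cc: "cos (?j * x) * cos (?j' * x) = (cos (2 * real_of_int p * x) + cos (2 * real_of_int q * x)) / 2"
    and ss: "sin (?j * x) * sin (?j' * x) = (cos (2 * real_of_int p * x) - cos (2 * real_of_int q * x)) / 2"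
    and sc: "sin (?j * x) * cos (?j' * x) = (sin (2 * real_of_int q * x) + sin (2 * real_of_int p * x)) / 2"
    and cs: "cos (?j * x) * sin (?j' * x) = (sin (2 * real_of_int q * x) - sin (2 * real_of_int p * x)) / 2" for x
    unfolding j [symmetric] left_diff_distrib distrib_right
    by (rule cos_times_cos sin_times_sin sin_times_cos cos_times_sin)+
  note sums = sum.distrib sum_subtractf sum_divide_distrib [symmetric] sum_cos_xi_angle[OF pq(1)]
    sum_cos_xi_angle[OF pq(2)] sum_sin_xi_angle[OF pq(1)] sum_sin_xi_angle[OF pq(2)]
  have q0: "q = 0 \<longleftrightarrow> 2 * l = k \<and> 2 * l' = k" and p0: "p = 0 \<longleftrightarrow> l = l'"
    using le by (auto simp: p_def q_def)
  let ?L = "\<Sum>\<nu>\<le>n. S_trig (k - 2 * l) \<epsilon> (xi_angle n \<nu>) * S_trig (k - 2 * l') \<epsilon>' (xi_angle n \<nu>)"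
  from le(3,4) consider "\<epsilon> = 0" "\<epsilon>' = 0" | "\<epsilon> = 1" "\<epsilon>' = 1" | "\<epsilon> = 0" "\<epsilon>' = 1" | "\<epsilon> = 1" "\<epsilon>' = 0"
    by blast
  then show ?thesis
  proof cases
    case 1
    then have "?L = ((if p = 0 then real n + 1 else 0) + (if q = 0 then real n + 1 else 0)) / 2"
      by (simp only: S_trig_def simp_thms if_True cc sums)
    then show ?thesis using 1 le by (auto simp: p0 q0 d_coef_def)
  next
    case 2
    then have "?L = ((if p = 0 then real n + 1 else 0) - (if q = 0 then real n + 1 else 0)) / 2"
      by (simp only: S_trig_def one_neq_zero if_False ss sums)
    then show ?thesis using 2 le by (auto simp: p0 q0 d_coef_def)
  next
    case 3
    then have "?L = (0 - 0) / 2"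
      by (simp only: S_trig_def one_neq_zero simp_thms if_False if_True cs sums)
    then show ?thesis using 3 by simp
  next
    case 4
    then have "?L = (0 + 0) / 2"
      by (simp only: S_trig_def one_neq_zero simp_thms if_False if_True sc sums)
    then show ?thesis using 4 by simp
  qed
qed

lemma finite_admissible: "finite (admissible k)"
  by (rule finite_subset[of _ "{..k} \<times> {0, 1}"]) (auto simp: admissible_def)

lemma sum_basis_coef_D_ker:
  assumes mu: "\<mu> > -1/2" and k: "k \<le> n" and adm: "(l, \<epsilon>) \<in> admissible k"
  shows "(\<Sum>\<nu>\<le>n. basis_coef \<mu> k l * S_trig (k - 2 * l) \<epsilon> (xi_angle n \<nu>) * D_ker \<mu> k (xi_angle n \<nu>) z) =
    (real n + 1) * disk_basis \<mu> k l \<epsilon> z"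
proof -
  let ?S = "\<lambda>l \<epsilon> \<nu>. S_trig (k - 2 * l) \<epsilon> (xi_angle n \<nu>)"
  have "(\<Sum>\<nu>\<le>n. basis_coef \<mu> k l * ?S l \<epsilon> \<nu> * D_ker \<mu> k (xi_angle n \<nu>) z) =
      (\<Sum>\<nu>\<le>n. \<Sum>(l', \<epsilon>')\<in>admissible k. basis_coef \<mu> k l * lam_coef \<mu> l' k * basis_coef \<mu> k l' *
         disk_basis \<mu> k l' \<epsilon>' z * (?S l \<epsilon> \<nu> * ?S l' \<epsilon>' \<nu>))"
    unfolding D_ker_def sum_distrib_left
    by (intro sum.cong refl) (auto simp: disk_basis_circle[OF mu])
  also have "\<dots> = (\<Sum>(l', \<epsilon>')\<in>admissible k. basis_coef \<mu> k l * lam_coef \<mu> l' k * basis_coef \<mu> k l' *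
         disk_basis \<mu> k l' \<epsilon>' z * (\<Sum>\<nu>\<le>n. ?S l \<epsilon> \<nu> * ?S l' \<epsilon>' \<nu>))"
    by (subst sum.swap) (simp add: sum_distrib_left case_prod_unfold)
  also have "\<dots> = (\<Sum>p\<in>admissible k. if p = (l, \<epsilon>) then basis_coef \<mu> k l * lam_coef \<mu> l k * basis_coef \<mu> k l *
         disk_basis \<mu> k l \<epsilon> z * ((real n + 1) * d_coef l k) else 0)"
    by (intro sum.cong refl) (auto simp: sum_S_trig_xi_angle[OF k adm] split: if_splits)
  also have "\<dots> = (lam_coef \<mu> l k * (basis_coef \<mu> k l)\<^sup>2 * d_coef l k) * ((real n + 1) * disk_basis \<mu> k l \<epsilon> z)"
    using adm by (simp add: finite_admissible power2_eq_square mult_ac)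
  also have "\<dots> = (real n + 1) * disk_basis \<mu> k l \<epsilon> z"
    using lam_basis_coef[OF mu, of l k] adm by (simp add: admissible_def)
  finally show ?thesis .
qed

lemma D_ker_in_Pi2:
  assumes mu: "\<mu> > -1/2"
  shows "D_ker \<mu> k \<xi> \<in> Pi2 k"
proof -
  have "(\<lambda>z. \<Sum>p\<in>admissible k. lam_coef \<mu> (fst p) k * disk_basis \<mu> k (fst p) (snd p) (cos \<xi>, sin \<xi>) *
      disk_basis \<mu> k (fst p) (snd p) z) \<in> Pi2 k"
    by (intro Pi2_sum Pi2_scale disk_basis_in_Pi2[OF mu]) (auto simp: admissible_def)
  then show ?thesis by (simp add: D_ker_def [abs_def] case_prod_unfold)
qed

lemma A_op_in_Pi2:
  assumes mu: "\<mu> > -1/2"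
  shows "A_op \<mu> n t w f \<in> Pi2 n"
proof -
  have "Phi_ker \<mu> n \<xi> s \<in> Pi2 n" for \<xi> s
    unfolding Phi_ker_def [abs_def] by (intro Pi2_sum Pi2_scale Pi2_mono[OF D_ker_in_Pi2[OF mu]]) auto
  then show ?thesis
    unfolding A_op_def [abs_def] T_fun_def by (intro Pi2_sum Pi2_scale)
qed

lemma A_op_linear:
  assumes mu: "\<mu> > -1/2" and t: "\<And>j. j \<le> n \<Longrightarrow> -1 < t j \<and> t j < 1"
    and f: "continuous_on unit_disk f" and g: "continuous_on unit_disk g"
  shows "A_op \<mu> n t w (\<lambda>z. c * f z + d * g z) = (\<lambda>z. c * A_op \<mu> n t w f z + d * A_op \<mu> n t w g z)"
proof
  fix z
  have "A_op \<mu> n t w (\<lambda>z. c * f z + d * g z) z =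
    (\<Sum>\<nu>\<le>n. \<Sum>j\<le>n. c * (radon \<mu> (xi_angle n \<nu>) f (t j) * T_fun \<mu> n t w j \<nu> z) +
       d * (radon \<mu> (xi_angle n \<nu>) g (t j) * T_fun \<mu> n t w j \<nu> z))"
    unfolding A_op_def using t
    by (intro sum.cong refl) (auto simp: radon_linear[OF mu _ _ f g] algebra_simps)
  then show "A_op \<mu> n t w (\<lambda>z. c * f z + d * g z) z = c * A_op \<mu> n t w f z + d * A_op \<mu> n t w g z"
    by (simp add: A_op_def sum.distrib sum_distrib_left)
qed

text \<open>At the nodes the factor (1 - t^2)^mu of the projection cancels against its inverse in
  \<open>T_fun\<close>, leaving products of two polynomials of degree at most n, for which the rule
  is exact. The mass of (1 - t^2)^mu that survives completes a_mu and the chord mass to 1.\<close>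

lemma A_op_disk_basis:
  assumes mu: "\<mu> > -1/2" and t: "\<And>j. j \<le> n \<Longrightarrow> -1 < t j \<and> t j < 1"
    and quad: "\<And>g. degree g \<le> 2 * n \<Longrightarrow> (\<Sum>j\<le>n. w j * poly g (t j)) = jacobi_int \<mu> \<mu> g"
    and k: "k \<le> n" and adm: "(l, \<epsilon>) \<in> admissible k"
  shows "A_op \<mu> n t w (disk_basis \<mu> k l \<epsilon>) z = disk_basis \<mu> k l \<epsilon> z"
proof -
  define N where "N = jacobi_norm \<mu> \<mu>"
  define H where "H = jacobi_hyp \<mu> \<mu>"
  define b where "b = (\<lambda>\<nu>. basis_coef \<mu> k l * S_trig (k - 2 * l) \<epsilon> (xi_angle n \<nu>))"
  define C where "C = a_const \<mu> * moment (\<mu> - 1/2) 0 / (real n + 1)"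
  have mu1: "\<mu> > -1" and mu2: "\<mu> + \<mu> > -1" using mu by auto
  have l: "2 * l \<le> k" using adm by (auto simp: admissible_def)
  have N: "N m > 0" for m unfolding N_def by (rule jacobi_norm_pos[OF mu1 mu1 mu2])
  have deg: "degree (H m) = m" for m by (simp add: H_def degree_jacobi_hyp[OF mu1 mu1])
  have orth: "(\<Sum>j\<le>n. w j * (poly (H k) (t j) * poly (H m) (t j))) =
      (if m = k then N k * jacobi_int \<mu> \<mu> 1 else 0)" if "m \<le> n" for m
  proof -
    have "(\<Sum>j\<le>n. w j * (poly (H k) (t j) * poly (H m) (t j))) = jacobi_int \<mu> \<mu> (H k * H m)"
      using quad[of "H k * H m"] degree_mult_le[of "H k" "H m"] k that by (simp add: deg)
    also have "\<dots> = (if m = k then N k * jacobi_int \<mu> \<mu> 1 else 0)"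
      using jacobi_int_hyp_square[OF mu1 mu1 mu2, of k] jacobi_hyp_orthogonal[OF mu1 mu1, of "H m" k]
        jacobi_hyp_orthogonal[OF mu1 mu1, of "H k" m] deg
      by (cases m k rule: linorder_cases) (auto simp: H_def N_def mult.commute)
    finally show ?thesis .
  qed
  have Phi: "Phi_ker \<mu> n \<xi> s z = (\<Sum>m\<le>n. poly (H m) s / N m * D_ker \<mu> m \<xi> z)" for \<xi> s
    unfolding Phi_ker_def H_def N_def by (simp only: gegenbauer_jacobi_norm[OF mu])
  have "A_op \<mu> n t w (disk_basis \<mu> k l \<epsilon>) z =
      (\<Sum>\<nu>\<le>n. \<Sum>j\<le>n. \<Sum>m\<le>n. C * b \<nu> * (D_ker \<mu> m (xi_angle n \<nu>) z / N m) *
         (w j * (poly (H k) (t j) * poly (H m) (t j))))"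
    unfolding A_op_def T_fun_def Phi sum_distrib_left
  proof (intro sum.cong refl)
    fix \<nu> j m assume "j \<in> {..n}"
    then have tj: "-1 < t j" "t j < 1" using t by auto
    then have "1 - (t j)\<^sup>2 > 0" by (simp add: abs_square_less_1 abs_less_iff)
    then have p: "(1 - (t j)\<^sup>2) powr \<mu> * (1 - (t j)\<^sup>2) powr (- \<mu>) = 1"
      by (simp add: powr_minus)
    have "radon \<mu> (xi_angle n \<nu>) (disk_basis \<mu> k l \<epsilon>) (t j) *
        (a_const \<mu> * w j / (real n + 1) * (1 - (t j)\<^sup>2) powr - \<mu> *
         (poly (H m) (t j) / N m * D_ker \<mu> m (xi_angle n \<nu>) z)) =
        ((1 - (t j)\<^sup>2) powr \<mu> * (1 - (t j)\<^sup>2) powr (- \<mu>)) * (C * b \<nu> * (D_ker \<mu> m (xi_angle n \<nu>) z / N m) *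
         (w j * (poly (H k) (t j) * poly (H m) (t j))))"
      unfolding radon_disk_basis[OF mu tj l] by (simp add: C_def b_def H_def)
    then show "radon \<mu> (xi_angle n \<nu>) (disk_basis \<mu> k l \<epsilon>) (t j) *
        (a_const \<mu> * w j / (real n + 1) * (1 - (t j)\<^sup>2) powr - \<mu> *
         (poly (H m) (t j) / N m * D_ker \<mu> m (xi_angle n \<nu>) z)) =
        C * b \<nu> * (D_ker \<mu> m (xi_angle n \<nu>) z / N m) *
         (w j * (poly (H k) (t j) * poly (H m) (t j)))"
      unfolding p by simp
  qed
  also have "\<dots> = (\<Sum>\<nu>\<le>n. \<Sum>m\<le>n. C * b \<nu> * (D_ker \<mu> m (xi_angle n \<nu>) z / N m) *
         (\<Sum>j\<le>n. w j * (poly (H k) (t j) * poly (H m) (t j))))"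
    by (subst sum.swap) (simp add: sum_distrib_left)
  also have "\<dots> = (\<Sum>\<nu>\<le>n. \<Sum>m\<le>n. if m = k then C * jacobi_int \<mu> \<mu> 1 * (b \<nu> * D_ker \<mu> k (xi_angle n \<nu>) z) else 0)"
    using N[of k] by (intro sum.cong refl) (auto simp: orth)
  also have "\<dots> = C * jacobi_int \<mu> \<mu> 1 * (\<Sum>\<nu>\<le>n. b \<nu> * D_ker \<mu> k (xi_angle n \<nu>) z)"
    using k by (simp add: sum_distrib_left)
  also have "\<dots> = a_const \<mu> * moment (\<mu> - 1/2) 0 * jacobi_int \<mu> \<mu> 1 * disk_basis \<mu> k l \<epsilon> z"
    unfolding b_def sum_basis_coef_D_ker[OF mu k adm] C_def by simp
  finally show ?thesis by (simp add: total_mass[OF mu])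
qed

theorem theorem2p14:
  fixes \<mu> a :: real and n :: nat and t w :: "nat \<Rightarrow> real"
  assumes mu: "\<mu> \<ge> 0"
    and nodes_distinct: "inj_on t {..n}"
    and nodes_interior: "\<forall>j\<le>n. -1 < t j \<and> t j < 1"
    and nodes_zeros: "\<forall>j\<le>n. poly (gegenbauer (\<mu> + 1/2) (n + 1)) (t j)
                         + a * poly (gegenbauer (\<mu> + 1/2) n) (t j) = 0"
    and weights_pos: "\<forall>j\<le>n. w j > 0"
    and quadrature: "\<forall>g :: real poly. degree g \<le> 2 * n \<longrightarrow>
          (LBINT s:{-1..1}. poly g s * (1 - s\<^sup>2) powr \<mu>) = (\<Sum>j\<le>n. w j * poly g (t j))"
  shows "(\<forall>f g c d. continuous_on unit_disk f \<longrightarrow> continuous_on unit_disk g \<longrightarrow>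
            A_op \<mu> n t w (\<lambda>z. c * f z + d * g z)
              = (\<lambda>z. c * A_op \<mu> n t w f z + d * A_op \<mu> n t w g z))
       \<and> (\<forall>f. continuous_on unit_disk f \<longrightarrow> A_op \<mu> n t w f \<in> Pi2 n)
       \<and> (\<forall>P \<in> Pi2 n. A_op \<mu> n t w P = P)"
proof -
  have mu': "\<mu> > -1/2" using mu by linarith
  have t: "-1 < t j \<and> t j < 1" if "j \<le> n" for j using nodes_interior that by blast
  have quad: "(\<Sum>j\<le>n. w j * poly g (t j)) = jacobi_int \<mu> \<mu> g" if "degree g \<le> 2 * n" for g
    using quadrature that by (metis gegenbauer_int_eq)
  note linear = A_op_linear[OF mu' t]
  \<comment> \<open>The fixed functions form a linear space because the operator is linear;
    continuity is included since linearity is available only for functions continuous on the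
    disk.\<close>
  define Z where "Z = {P. continuous_on unit_disk P \<and> A_op \<mu> n t w P = P}"
  interpret contains_disk_basis \<mu> n Z
  proof
    show "\<mu> > -1/2" by (rule mu')
  next
    fix P Q assume "P \<in> Z" "Q \<in> Z"
    then show "(\<lambda>z. P z + Q z) \<in> Z"
      using linear[where f = P and g = Q and w = w and c = 1 and d = 1] by (auto simp: Z_def intro!: continuous_intros)
  next
    fix c P assume "P \<in> Z"
    then show "(\<lambda>z. c * P z) \<in> Z"
      using linear[where f = P and g = P and w = w and c = c and d = 0] by (auto simp: Z_def intro!: continuous_intros)
  next
    fix k l \<epsilon> assume "k \<le> n" "(l, \<epsilon>) \<in> admissible k"
    moreover from this have "disk_basis \<mu> k l \<epsilon> \<in> Pi2 k"
      by (intro disk_basis_in_Pi2 mu') (auto simp: admissible_def)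
    ultimately show "disk_basis \<mu> k l \<epsilon> \<in> Z"
      using A_op_disk_basis[OF mu' t quad] by (auto simp: Z_def continuous_on_Pi2)
  qed
  show ?thesis
    using linear A_op_in_Pi2[OF mu'] Pi2_subset by (auto simp: Z_def)
qed

end
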